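(* Let $n\ge0$, let $\mathcal C$ be an $n$-Frobenius category, let $X,Z\in\mathcal C$ and $\gamma\in\operatorname{Ext}^n(Z,X)$. The following are equivalent: (1) there are an $n$-projective object $P$, an element $\eta\in\operatorname{Ext}^n(P,X)$ and a morphism $f:Z\to P$ such that $\gamma=\eta f$; (2) there are an $n$-projective object $Q$, an element $\eta'\in\operatorname{Ext}^n(Z,Q)$ and a morphism $f':Q\to X$ such that $\gamma=f'\eta'$.
   Context: Let $\mathcal A$ be an abelian category and $\mathcal C$ a full additive extension-closed subcategory with the inherited exact structure: conflations are short exact sequences of $\mathcal A$ with all terms in $\mathcal C$ (first map an inflation, second a deflation). $\operatorname{Ext}^t(A,B)=\operatorname{Ext}^t_{\mathcal C}(A,B)$ ($t\ge1$) is the abelian group (Baer sum) of equivalence classes of exact sequences $B\to X_{t-1}\to\cdots\to X_0\to A$ spliced from $t$ conflations; $\operatorname{Ext}^0=\operatorname{Hom}_{\mathcal C}$. $g\gamma$ and $\gamma h$ denote push-out along $g$ and pull-back along $h$ (compositions if $t=0$). $P\in\mathcal C$ is $n$-projective (resp. $n$-injective) if $\operatorname{Ext}^i(P,Y)=0$ (resp. $\operatorname{Ext}^i(Y,P)=0$) for all $i>n$ and $Y\in\mathcal C$. $\mathcal C$ is $n$-Frobenius if every object has a deflation from an $n$-projective and an inflation into an $n$-injective, and the $n$-projectives coincide with the $n$-injectives. *)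

theory Defs
  imports "HOL-Algebra.Group"
begin

section \<open>Abelian categories\<close>

text \<open>
  The addition and the zero morphisms of the hom groups are part of the data. A composite
  \<open>g \<cdot> f\<close> is meaningful only if the codomain of \<open>f\<close> is the domain of \<open>g\<close>.
\<close>

record ('o, 'm) ab_cat =
  Obj :: "'o set"
  Arr :: "'m set"
  Dom :: "'m \<Rightarrow> 'o"
  Cod :: "'m \<Rightarrow> 'o"
  Ident :: "'o \<Rightarrow> 'm"
  Comp :: "'m \<Rightarrow> 'm \<Rightarrow> 'm" (infixr "\<cdot>\<index>" 70)
  Plus :: "'m \<Rightarrow> 'm \<Rightarrow> 'm" (infixl "\<boxplus>\<index>" 65)
  ZeroMor :: "'o \<Rightarrow> 'o \<Rightarrow> 'm"

definition Hom :: "('o, 'm) ab_cat \<Rightarrow> 'o \<Rightarrow> 'o \<Rightarrow> 'm set" where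
  "Hom \<A> A B = {f \<in> Arr \<A>. Dom \<A> f = A \<and> Cod \<A> f = B}"

definition Hom_group :: "('o, 'm) ab_cat \<Rightarrow> 'o \<Rightarrow> 'o \<Rightarrow> 'm monoid" where
  "Hom_group \<A> A B = \<lparr>carrier = Hom \<A> A B, monoid.mult = Plus \<A>, one = ZeroMor \<A> A B\<rparr>"

locale category =
  fixes \<A> :: "('o, 'm) ab_cat" (structure)
  assumes Dom_Obj: "f \<in> Arr \<A> \<Longrightarrow> Dom \<A> f \<in> Obj \<A>"
    and Cod_Obj: "f \<in> Arr \<A> \<Longrightarrow> Cod \<A> f \<in> Obj \<A>"
    and Ident_Hom: "A \<in> Obj \<A> \<Longrightarrow> Ident \<A> A \<in> Hom \<A> A A"
    and Comp_Hom: "f \<in> Hom \<A> A B \<Longrightarrow> g \<in> Hom \<A> B D \<Longrightarrow> g \<cdot> f \<in> Hom \<A> A D"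
    and Comp_Ident: "f \<in> Hom \<A> A B \<Longrightarrow> f \<cdot> Ident \<A> A = f"
    and Ident_Comp: "f \<in> Hom \<A> A B \<Longrightarrow> Ident \<A> B \<cdot> f = f"
    and Comp_assoc: "f \<in> Hom \<A> A B \<Longrightarrow> g \<in> Hom \<A> B D \<Longrightarrow> h \<in> Hom \<A> D E \<Longrightarrow>
      (h \<cdot> g) \<cdot> f = h \<cdot> (g \<cdot> f)"

locale preadditive_category = category +
  assumes Hom_comm_group: "A \<in> Obj \<A> \<Longrightarrow> B \<in> Obj \<A> \<Longrightarrow> comm_group (Hom_group \<A> A B)"
    and Comp_Plus: "f \<in> Hom \<A> A B \<Longrightarrow> f' \<in> Hom \<A> A B \<Longrightarrow> g \<in> Hom \<A> B D \<Longrightarrow>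
      g \<cdot> (f \<boxplus> f') = (g \<cdot> f) \<boxplus> (g \<cdot> f')"
    and Plus_Comp: "f \<in> Hom \<A> A B \<Longrightarrow> g \<in> Hom \<A> B D \<Longrightarrow> g' \<in> Hom \<A> B D \<Longrightarrow>
      (g \<boxplus> g') \<cdot> f = (g \<cdot> f) \<boxplus> (g' \<cdot> f)"

context
  fixes \<A> :: "('o, 'm) ab_cat" (structure)
begin

definition is_mono :: "'m \<Rightarrow> bool" where
  "is_mono f \<longleftrightarrow> f \<in> Arr \<A> \<and>
     (\<forall>W. \<forall>g \<in> Hom \<A> W (Dom \<A> f). \<forall>h \<in> Hom \<A> W (Dom \<A> f). f \<cdot> g = f \<cdot> h \<longrightarrow> g = h)"

definition is_epi :: "'m \<Rightarrow> bool" where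
  "is_epi f \<longleftrightarrow> f \<in> Arr \<A> \<and>
     (\<forall>W. \<forall>g \<in> Hom \<A> (Cod \<A> f) W. \<forall>h \<in> Hom \<A> (Cod \<A> f) W. g \<cdot> f = h \<cdot> f \<longrightarrow> g = h)"

definition is_zero_obj :: "'o \<Rightarrow> bool" where
  "is_zero_obj N \<longleftrightarrow> N \<in> Obj \<A> \<and>
     (\<forall>A \<in> Obj \<A>. (\<exists>!f. f \<in> Hom \<A> N A) \<and> (\<exists>!f. f \<in> Hom \<A> A N))"

definition is_biproduct :: "'o \<Rightarrow> 'o \<Rightarrow> 'o \<Rightarrow> 'm \<Rightarrow> 'm \<Rightarrow> 'm \<Rightarrow> 'm \<Rightarrow> bool" where
  "is_biproduct A B S i j p q \<longleftrightarrow>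
     i \<in> Hom \<A> A S \<and> j \<in> Hom \<A> B S \<and> p \<in> Hom \<A> S A \<and> q \<in> Hom \<A> S B \<and>
     p \<cdot> i = Ident \<A> A \<and> q \<cdot> j = Ident \<A> B \<and>
     p \<cdot> j = ZeroMor \<A> B A \<and> q \<cdot> i = ZeroMor \<A> A B \<and>
     (i \<cdot> p) \<boxplus> (j \<cdot> q) = Ident \<A> S"

definition is_kernel :: "'m \<Rightarrow> 'm \<Rightarrow> bool" where
  "is_kernel k f \<longleftrightarrow> f \<in> Arr \<A> \<and> k \<in> Arr \<A> \<and> Cod \<A> k = Dom \<A> f \<and>
     f \<cdot> k = ZeroMor \<A> (Dom \<A> k) (Cod \<A> f) \<and>
     (\<forall>W. \<forall>g \<in> Hom \<A> W (Dom \<A> f). f \<cdot> g = ZeroMor \<A> W (Cod \<A> f) \<longrightarrow>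
        (\<exists>!u. u \<in> Hom \<A> W (Dom \<A> k) \<and> k \<cdot> u = g))"

definition is_cokernel :: "'m \<Rightarrow> 'm \<Rightarrow> bool" where
  "is_cokernel c f \<longleftrightarrow> f \<in> Arr \<A> \<and> c \<in> Arr \<A> \<and> Dom \<A> c = Cod \<A> f \<and>
     c \<cdot> f = ZeroMor \<A> (Dom \<A> f) (Cod \<A> c) \<and>
     (\<forall>W. \<forall>g \<in> Hom \<A> (Cod \<A> f) W. g \<cdot> f = ZeroMor \<A> (Dom \<A> f) W \<longrightarrow>
        (\<exists>!u. u \<in> Hom \<A> (Cod \<A> c) W \<and> u \<cdot> c = g))"

definition short_exact :: "'m \<Rightarrow> 'm \<Rightarrow> bool" where
  "short_exact i p \<longleftrightarrow> is_kernel i p \<and> is_cokernel p i"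

text \<open>The square \<open>f' \<cdot> f = g' \<cdot> g\<close> is a push-out of \<open>f\<close> and \<open>g\<close>.\<close>

definition is_pushout :: "'m \<Rightarrow> 'm \<Rightarrow> 'm \<Rightarrow> 'm \<Rightarrow> bool" where
  "is_pushout f g f' g' \<longleftrightarrow> f \<in> Arr \<A> \<and> g \<in> Arr \<A> \<and> f' \<in> Arr \<A> \<and> g' \<in> Arr \<A> \<and>
     Dom \<A> f = Dom \<A> g \<and> Dom \<A> f' = Cod \<A> f \<and> Dom \<A> g' = Cod \<A> g \<and> Cod \<A> f' = Cod \<A> g' \<and>
     f' \<cdot> f = g' \<cdot> g \<and>
     (\<forall>W. \<forall>a \<in> Hom \<A> (Cod \<A> f) W. \<forall>b \<in> Hom \<A> (Cod \<A> g) W. a \<cdot> f = b \<cdot> g \<longrightarrow>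
        (\<exists>!u. u \<in> Hom \<A> (Cod \<A> f') W \<and> u \<cdot> f' = a \<and> u \<cdot> g' = b))"

text \<open>The square \<open>f \<cdot> f' = g \<cdot> g'\<close> is a pull-back of \<open>f\<close> and \<open>g\<close>.\<close>

definition is_pullback :: "'m \<Rightarrow> 'm \<Rightarrow> 'm \<Rightarrow> 'm \<Rightarrow> bool" where
  "is_pullback f g f' g' \<longleftrightarrow> f \<in> Arr \<A> \<and> g \<in> Arr \<A> \<and> f' \<in> Arr \<A> \<and> g' \<in> Arr \<A> \<and>
     Cod \<A> f = Cod \<A> g \<and> Cod \<A> f' = Dom \<A> f \<and> Cod \<A> g' = Dom \<A> g \<and> Dom \<A> f' = Dom \<A> g' \<and>
     f \<cdot> f' = g \<cdot> g' \<and>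
     (\<forall>W. \<forall>a \<in> Hom \<A> W (Dom \<A> f). \<forall>b \<in> Hom \<A> W (Dom \<A> g). f \<cdot> a = g \<cdot> b \<longrightarrow>
        (\<exists>!u. u \<in> Hom \<A> W (Dom \<A> f') \<and> f' \<cdot> u = a \<and> g' \<cdot> u = b))"

end

locale additive_category = preadditive_category +
  assumes ex_zero_obj: "\<exists>N. is_zero_obj \<A> N"
    and ex_biproduct: "A \<in> Obj \<A> \<Longrightarrow> B \<in> Obj \<A> \<Longrightarrow> \<exists>S i j p q. is_biproduct \<A> A B S i j p q"

locale abelian_category = additive_category +
  assumes ex_kernel: "f \<in> Arr \<A> \<Longrightarrow> \<exists>k. is_kernel \<A> k f"
    and ex_cokernel: "f \<in> Arr \<A> \<Longrightarrow> \<exists>c. is_cokernel \<A> c f"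
    and mono_normal: "is_mono \<A> f \<Longrightarrow> \<exists>g. is_kernel \<A> f g"
    and epi_normal: "is_epi \<A> f \<Longrightarrow> \<exists>g. is_cokernel \<A> f g"

text \<open>The full subcategory is given by its set of objects \<open>\<C>\<close>.\<close>

locale extension_closed_subcategory = abelian_category +
  fixes \<C> :: "'a set"
  assumes sub_Obj: "\<C> \<subseteq> Obj \<A>"
    and sub_zero_obj: "\<exists>N \<in> \<C>. is_zero_obj \<A> N"
    and sub_biproduct:
      "A \<in> \<C> \<Longrightarrow> B \<in> \<C> \<Longrightarrow> \<exists>S \<in> \<C>. \<exists>i j p q. is_biproduct \<A> A B S i j p q"
    and extension_closed:
      "short_exact \<A> i p \<Longrightarrow> Dom \<A> i \<in> \<C> \<Longrightarrow> Cod \<A> p \<in> \<C> \<Longrightarrow> Cod \<A> i \<in> \<C>"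


section \<open>Yoneda extensions\<close>

context
  fixes \<A> :: "('o, 'm) ab_cat" (structure) and \<C> :: "'o set"
begin

definition conflation :: "'m \<Rightarrow> 'm \<Rightarrow> bool" where
  "conflation i p \<longleftrightarrow> short_exact \<A> i p \<and> Dom \<A> i \<in> \<C> \<and> Cod \<A> i \<in> \<C> \<and> Cod \<A> p \<in> \<C>"

definition inflation :: "'m \<Rightarrow> bool" where
  "inflation i \<longleftrightarrow> (\<exists>p. conflation i p)"

definition deflation :: "'m \<Rightarrow> bool" where
  "deflation p \<longleftrightarrow> (\<exists>i. conflation i p)"

definition split_conflation :: "'m \<Rightarrow> 'm \<Rightarrow> bool" where
  "split_conflation i p \<longleftrightarrow> conflation i p \<and>
     (\<exists>q j. is_biproduct \<A> (Dom \<A> i) (Cod \<A> p) (Cod \<A> i) i j q p)"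

text \<open>
  \<open>spliced R t A B ds\<close>: the exact sequence \<open>B \<rightarrow> X\<^bsub>t-1\<^esub> \<rightarrow> \<dots> \<rightarrow> X\<^bsub>0\<^esub> \<rightarrow> A\<close>, whose \<open>t + 1\<close> morphisms
  are listed in \<open>ds\<close> from left to right, is spliced from \<open>t \<ge> 1\<close> conflations satisfying \<open>R\<close>.
\<close>

inductive spliced :: "('m \<Rightarrow> 'm \<Rightarrow> bool) \<Rightarrow> nat \<Rightarrow> 'o \<Rightarrow> 'o \<Rightarrow> 'm list \<Rightarrow> bool"
  for R where
  single: "R i p \<Longrightarrow> Dom \<A> i = B \<Longrightarrow> Cod \<A> p = A \<Longrightarrow> spliced R 1 A B [i, p]"
| splice: "R i p \<Longrightarrow> Dom \<A> i = B \<Longrightarrow> Cod \<A> p = K \<Longrightarrow> spliced R t A K (j # ds) \<Longrightarrow>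
    spliced R (Suc t) A B (i # (j \<cdot> p) # ds)"

text \<open>
  In degree \<open>0\<close> a morphism \<open>f : A \<rightarrow> B\<close> is encoded as the one-element list \<open>[f]\<close>; note that in
  positive degree the lists lead from \<open>B\<close> to \<open>A\<close>.
\<close>

definition ext_seqs :: "nat \<Rightarrow> 'o \<Rightarrow> 'o \<Rightarrow> 'm list set" where
  "ext_seqs t A B = (if t = 0 then {[f] |f. f \<in> Hom \<A> A B} else {ds. spliced conflation t A B ds})"

text \<open>
  A morphism of exact sequences which is the identity on both ends: \<open>\<phi> 0\<close> and \<open>\<phi> (t + 1)\<close>
  act on \<open>B\<close> and \<open>A\<close>, and \<open>\<phi> k\<close> on the domain of the \<open>k\<close>-th morphism of the list.
\<close>

definition ext_step :: "nat \<Rightarrow> 'o \<Rightarrow> 'o \<Rightarrow> 'm list \<Rightarrow> 'm list \<Rightarrow> bool" where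
  "ext_step t A B ds es \<longleftrightarrow> ds \<in> ext_seqs t A B \<and> es \<in> ext_seqs t A B \<and>
     (\<exists>\<phi> :: nat \<Rightarrow> 'm. \<phi> 0 = Ident \<A> B \<and> \<phi> (t + 1) = Ident \<A> A \<and>
        (\<forall>k \<le> t. \<phi> k \<in> Hom \<A> (Dom \<A> (ds ! k)) (Dom \<A> (es ! k)) \<and>
                 \<phi> (k + 1) \<cdot> (ds ! k) = (es ! k) \<cdot> \<phi> k))"

definition ext_rel :: "nat \<Rightarrow> 'o \<Rightarrow> 'o \<Rightarrow> ('m list \<times> 'm list) set" where
  "ext_rel t A B =
     (if t = 0 then Id_on (ext_seqs 0 A B)
      else {(ds, es). ds \<in> ext_seqs t A B \<and> es \<in> ext_seqs t A B \<and> equivclp (ext_step t A B) ds es})"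

definition Ext :: "nat \<Rightarrow> 'o \<Rightarrow> 'o \<Rightarrow> 'm list set set" where
  "Ext t A B = ext_seqs t A B // ext_rel t A B"

text \<open>
  \<open>push_seq g ds es\<close>: \<open>es\<close> is a push-out of \<open>ds\<close> along \<open>g\<close>. In positive degree the first
  morphism \<open>d\<close> is pushed out along \<open>g\<close>, and the second one is replaced by the morphism induced on
  the push-out.
\<close>

inductive push_seq :: "'m \<Rightarrow> 'm list \<Rightarrow> 'm list \<Rightarrow> bool" for g where
  push_hom: "Cod \<A> f = Dom \<A> g \<Longrightarrow> push_seq g [f] [g \<cdot> f]"
| push_ext: "is_pushout \<A> d g u d' \<Longrightarrow> e' \<in> Hom \<A> (Cod \<A> d') (Cod \<A> e) \<Longrightarrow>
    e' \<cdot> u = e \<Longrightarrow> e' \<cdot> d' = ZeroMor \<A> (Dom \<A> d') (Cod \<A> e) \<Longrightarrow>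
    push_seq g (d # e # ds) (d' # e' # ds)"

inductive pull_seq :: "'m \<Rightarrow> 'm list \<Rightarrow> 'm list \<Rightarrow> bool" for h where
  pull_hom: "Cod \<A> h = Dom \<A> f \<Longrightarrow> pull_seq h [f] [f \<cdot> h]"
| pull_ext: "is_pullback \<A> d h u d' \<Longrightarrow> e' \<in> Hom \<A> (Dom \<A> e) (Dom \<A> d') \<Longrightarrow>
    u \<cdot> e' = e \<Longrightarrow> d' \<cdot> e' = ZeroMor \<A> (Dom \<A> e) (Cod \<A> d') \<Longrightarrow>
    pull_seq h (ds @ [e, d]) (ds @ [e', d'])"

text \<open>
  The products \<open>g\<gamma>\<close> and \<open>\<gamma>h\<close> for \<open>\<gamma> \<in> Ext t A B\<close>, \<open>g\<close> with domain \<open>B\<close> and \<open>h\<close> with codomain \<open>A\<close>.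
  Taking the image under \<open>ext_rel\<close> completes the set of all representatives obtained in this way
  to a full equivalence class.
\<close>

definition ext_push :: "nat \<Rightarrow> 'o \<Rightarrow> 'm \<Rightarrow> 'm list set \<Rightarrow> 'm list set" where
  "ext_push t A g \<gamma> = ext_rel t A (Cod \<A> g) `` {es. \<exists>ds \<in> \<gamma>. push_seq g ds es}"

definition ext_pull :: "nat \<Rightarrow> 'o \<Rightarrow> 'm list set \<Rightarrow> 'm \<Rightarrow> 'm list set" where
  "ext_pull t B \<gamma> h = ext_rel t (Dom \<A> h) B `` {es. \<exists>ds \<in> \<gamma>. pull_seq h ds es}"

text \<open>
  \<open>ss\<close> is a termwise direct sum of \<open>ds\<close> and \<open>es\<close>; \<open>i k, j k\<close> and \<open>p k, q k\<close> are the injections and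
  projections of its \<open>k\<close>-th object (counted from the left).
\<close>

definition direct_sum_seq ::
  "nat \<Rightarrow> 'o \<Rightarrow> 'o \<Rightarrow> 'm list \<Rightarrow> 'm list \<Rightarrow> 'm list \<Rightarrow>
   (nat \<Rightarrow> 'm) \<Rightarrow> (nat \<Rightarrow> 'm) \<Rightarrow> (nat \<Rightarrow> 'm) \<Rightarrow> (nat \<Rightarrow> 'm) \<Rightarrow> bool" where
  "direct_sum_seq t A B ds es ss i j p q \<longleftrightarrow> length ss = t + 1 \<and>
     is_biproduct \<A> A A (Cod \<A> (ss ! t)) (i (t + 1)) (j (t + 1)) (p (t + 1)) (q (t + 1)) \<and>
     (\<forall>k \<le> t. is_biproduct \<A> (Dom \<A> (ds ! k)) (Dom \<A> (es ! k)) (Dom \<A> (ss ! k)) (i k) (j k) (p k) (q k) \<and>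
        ss ! k = (i (k + 1) \<cdot> (ds ! k) \<cdot> p k) \<boxplus> (j (k + 1) \<cdot> (es ! k) \<cdot> q k))"

text \<open>
  The Baer sum is \<open>\<nabla>(\<gamma> \<oplus> \<gamma>')\<Delta>\<close>, where \<open>\<nabla> = p + q : B \<oplus> B \<rightarrow> B\<close> and \<open>\<Delta> = i + j : A \<rightarrow> A \<oplus> A\<close>.
\<close>

definition baer_sum :: "nat \<Rightarrow> 'o \<Rightarrow> 'o \<Rightarrow> 'm list set \<Rightarrow> 'm list set \<Rightarrow> 'm list set" where
  "baer_sum t A B \<gamma> \<gamma>' =
     (if t = 0 then {[f \<boxplus> g] |f g. [f] \<in> \<gamma> \<and> [g] \<in> \<gamma>'}
      else ext_rel t A B `` {zs. \<exists>ds \<in> \<gamma>. \<exists>es \<in> \<gamma>'. \<exists>ss ys i j p q.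
        direct_sum_seq t A B ds es ss i j p q \<and>
        push_seq (p 0 \<boxplus> q 0) ss ys \<and> pull_seq (i (t + 1) \<boxplus> j (t + 1)) ys zs})"

text \<open>The neutral element is the class of the sequences spliced from split conflations.\<close>

definition ext_zero :: "nat \<Rightarrow> 'o \<Rightarrow> 'o \<Rightarrow> 'm list set" where
  "ext_zero t A B =
     (if t = 0 then {[ZeroMor \<A> A B]} else ext_rel t A B `` {ds. spliced split_conflation t A B ds})"

definition Ext_group :: "nat \<Rightarrow> 'o \<Rightarrow> 'o \<Rightarrow> 'm list set monoid" where
  "Ext_group t A B = \<lparr>carrier = Ext t A B, monoid.mult = baer_sum t A B, one = ext_zero t A B\<rparr>"

definition Ext_vanishes :: "nat \<Rightarrow> 'o \<Rightarrow> 'o \<Rightarrow> bool" where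
  "Ext_vanishes t A B \<longleftrightarrow> carrier (Ext_group t A B) = {\<one>\<^bsub>Ext_group t A B\<^esub>}"


section \<open>\<open>n\<close>-Frobenius categories\<close>

definition n_projective :: "nat \<Rightarrow> 'o \<Rightarrow> bool" where
  "n_projective n P \<longleftrightarrow> P \<in> \<C> \<and> (\<forall>t > n. \<forall>Y \<in> \<C>. Ext_vanishes t P Y)"

definition n_injective :: "nat \<Rightarrow> 'o \<Rightarrow> bool" where
  "n_injective n P \<longleftrightarrow> P \<in> \<C> \<and> (\<forall>t > n. \<forall>Y \<in> \<C>. Ext_vanishes t Y P)"

definition n_Frobenius :: "nat \<Rightarrow> bool" where
  "n_Frobenius n \<longleftrightarrow>
     (\<forall>X \<in> \<C>. \<exists>P p. n_projective n P \<and> p \<in> Hom \<A> P X \<and> deflation p) \<and>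
     (\<forall>X \<in> \<C>. \<exists>I i. n_injective n I \<and> i \<in> Hom \<A> X I \<and> inflation i) \<and>
     (\<forall>P. n_projective n P \<longleftrightarrow> n_injective n P)"

end

end

theory Submission
  imports Defs
begin

text \<open>
  For \<open>\<gamma> = \<eta>f\<close> with \<open>\<eta> \<in> Ext\<^sup>n(P, X)\<close> choose a conflation \<open>X' \<rightarrow> Q \<rightarrow> X\<close> with \<open>Q\<close> \<open>n\<close>-projective. Its
  product with \<open>\<eta>\<close> lies in \<open>Ext\<^sup>n\<^sup>+\<^sup>1(P, X') = 0\<close>, so \<open>\<eta>\<close> lifts to \<open>\<eta>'' \<in> Ext\<^sup>n(P, Q)\<close>, and \<open>\<eta>''f\<close> is the
  element sought; the converse is dual. For the lift, vanishing of a class has to be turned into a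
  chain map. Call a sequence left null if it receives a chain map that is zero at the left end and the
  identity at the right end, and right null if it admits a chain map that is the identity at the left
  end and zero at the right end. The first condition passes forwards along chain maps with identities
  at both ends, the second one backwards. An inductive push-out construction shows that left null
  implies right null, and duality gives the converse, so that every sequence equivalent to a split one
  is left null. The lift is read off the chain map witnessing this.
\<close>

section \<open>Calculus in abelian categories\<close>

text \<open>The obstacle is that equality of classes only provides a zigzag of chain maps, so
  vanishing does not directly supply a morphism. Each of the two null conditions evidently passes
  along chain maps in one direction only; their equivalence is what carries them through a zigzag
  with arrows both ways. The lift is read off as follows. The component of the witnessing chain map
  that lands in \<open>Q\<close> kills the leading inflation of the witness and descends to a
  morphism \<open>g : N \<rightarrow> Q\<close> on its cokernel; the rest of the witness is pushed
  out along \<open>g\<close>. The pull-back along \<open>f\<close> is built into this step, so a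
  representative of \<open>\<eta>''f\<close> is obtained at once. Push-outs are formed in the
  abelian category, and the middle terms stay in the subcategory because they are extensions.
  Pull-backs are push-outs in the opposite category, with lists of morphisms reversed. In degree 0
  both conditions say that the morphism factors through an \<open>n\<close>-projective
  object.\<close>

lemma Hom_iff: "f \<in> Hom \<A> A B \<longleftrightarrow> f \<in> Arr \<A> \<and> Dom \<A> f = A \<and> Cod \<A> f = B"
  by (auto simp: Hom_def)

context category
begin

text \<open>Phrasing the axioms with \<open>Arr\<close>, \<open>Dom\<close> and \<open>Cod\<close>
  instead of \<open>Hom\<close> turns typing conditions into equations that the simplifier can
  discharge.\<close>

lemma Comp_Arr [simp]: "f \<in> Arr \<A> \<Longrightarrow> g \<in> Arr \<A> \<Longrightarrow> Cod \<A> f = Dom \<A> g \<Longrightarrow> g \<cdot> f \<in> Arr \<A>"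
  and Dom_Comp [simp]: "f \<in> Arr \<A> \<Longrightarrow> g \<in> Arr \<A> \<Longrightarrow> Cod \<A> f = Dom \<A> g \<Longrightarrow> Dom \<A> (g \<cdot> f) = Dom \<A> f"
  and Cod_Comp [simp]: "f \<in> Arr \<A> \<Longrightarrow> g \<in> Arr \<A> \<Longrightarrow> Cod \<A> f = Dom \<A> g \<Longrightarrow> Cod \<A> (g \<cdot> f) = Cod \<A> g"
  using Comp_Hom[of f "Dom \<A> f" "Cod \<A> f" g "Cod \<A> g"] by (auto simp: Hom_iff)

lemma Ident_Arr [simp]: "A \<in> Obj \<A> \<Longrightarrow> Ident \<A> A \<in> Arr \<A>"
  and Dom_Ident [simp]: "A \<in> Obj \<A> \<Longrightarrow> Dom \<A> (Ident \<A> A) = A"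
  and Cod_Ident [simp]: "A \<in> Obj \<A> \<Longrightarrow> Cod \<A> (Ident \<A> A) = A"
  using Ident_Hom[of A] by (auto simp: Hom_iff)

lemma Comp_Ident_Arr [simp]: "f \<in> Arr \<A> \<Longrightarrow> Dom \<A> f = A \<Longrightarrow> f \<cdot> Ident \<A> A = f"
  and Ident_Comp_Arr [simp]: "f \<in> Arr \<A> \<Longrightarrow> Cod \<A> f = B \<Longrightarrow> Ident \<A> B \<cdot> f = f"
  using Comp_Ident[of f] Ident_Comp[of f] by (auto simp: Hom_iff)

lemma Comp_assoc_Arr:
  "f \<in> Arr \<A> \<Longrightarrow> g \<in> Arr \<A> \<Longrightarrow> h \<in> Arr \<A> \<Longrightarrow> Cod \<A> f = Dom \<A> g \<Longrightarrow> Cod \<A> g = Dom \<A> h \<Longrightarrow>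
    (h \<cdot> g) \<cdot> f = h \<cdot> (g \<cdot> f)"
  using Comp_assoc by (auto simp: Hom_iff)

declare Dom_Obj [simp] Cod_Obj [simp]

end

context preadditive_category
begin

lemma Zero_Arr [simp]: "A \<in> Obj \<A> \<Longrightarrow> B \<in> Obj \<A> \<Longrightarrow> ZeroMor \<A> A B \<in> Arr \<A>"
  and Dom_Zero [simp]: "A \<in> Obj \<A> \<Longrightarrow> B \<in> Obj \<A> \<Longrightarrow> Dom \<A> (ZeroMor \<A> A B) = A"
  and Cod_Zero [simp]: "A \<in> Obj \<A> \<Longrightarrow> B \<in> Obj \<A> \<Longrightarrow> Cod \<A> (ZeroMor \<A> A B) = B"
  using monoid.one_closed[of "Hom_group \<A> A B"] Hom_comm_group[of A B]
  by (auto simp: Hom_group_def Hom_iff comm_group_def group_def)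

lemma
  assumes "f \<in> Arr \<A>" "g \<in> Arr \<A>" "Dom \<A> f = Dom \<A> g" "Cod \<A> f = Cod \<A> g"
  shows Plus_Arr [simp]: "f \<boxplus> g \<in> Arr \<A>"
    and Dom_Plus [simp]: "Dom \<A> (f \<boxplus> g) = Dom \<A> g"
    and Cod_Plus [simp]: "Cod \<A> (f \<boxplus> g) = Cod \<A> g"
    and Plus_commute: "f \<boxplus> g = g \<boxplus> f"
proof -
  interpret comm_group "Hom_group \<A> (Dom \<A> f) (Cod \<A> f)"
    using Hom_comm_group assms by simp
  show "f \<boxplus> g \<in> Arr \<A>" "Dom \<A> (f \<boxplus> g) = Dom \<A> g" "Cod \<A> (f \<boxplus> g) = Cod \<A> g" "f \<boxplus> g = g \<boxplus> f"
    using m_closed[of f g] m_comm[of f g] assms by (auto simp: Hom_group_def Hom_iff)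
qed

lemma
  assumes "f \<in> Arr \<A>" "Dom \<A> f = A" "Cod \<A> f = B"
  shows Plus_Zero [simp]: "f \<boxplus> ZeroMor \<A> A B = f"
    and Zero_Plus [simp]: "ZeroMor \<A> A B \<boxplus> f = f"
proof -
  interpret comm_group "Hom_group \<A> A B"
    using Hom_comm_group assms by auto
  show "f \<boxplus> ZeroMor \<A> A B = f" "ZeroMor \<A> A B \<boxplus> f = f"
    using r_one[of f] l_one[of f] assms by (auto simp: Hom_group_def Hom_iff)
qed

lemma Plus_right_cancel:
  assumes "f \<boxplus> h = g \<boxplus> h" "f \<in> Arr \<A>" "g \<in> Arr \<A>" "h \<in> Arr \<A>"
    "Dom \<A> f = Dom \<A> h" "Cod \<A> f = Cod \<A> h" "Dom \<A> g = Dom \<A> h" "Cod \<A> g = Cod \<A> h"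
  shows "f = g"
proof -
  interpret comm_group "Hom_group \<A> (Dom \<A> h) (Cod \<A> h)"
    using Hom_comm_group assms by simp
  show ?thesis using right_cancel[of h f g] assms by (auto simp: Hom_group_def Hom_iff)
qed

text \<open>Subtraction is not part of the data, so a morphism \<open>d\<close> with
  \<open>d \<boxplus> g = f\<close> stands in for \<open>f - g\<close>; for \<open>f\<close> zero it
  supplies negatives.\<close>

lemma ex_difference:
  assumes "f \<in> Arr \<A>" "g \<in> Arr \<A>" "Dom \<A> f = Dom \<A> g" "Cod \<A> f = Cod \<A> g"
  obtains d where "d \<in> Arr \<A>" "Dom \<A> d = Dom \<A> g" "Cod \<A> d = Cod \<A> g" "d \<boxplus> g = f"
proof -
  interpret comm_group "Hom_group \<A> (Dom \<A> g) (Cod \<A> g)"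
    using Hom_comm_group assms by simp
  let ?G = "Hom_group \<A> (Dom \<A> g) (Cod \<A> g)"
  have g: "g \<in> carrier ?G" "f \<in> carrier ?G" using assms by (auto simp: Hom_group_def Hom_iff)
  have "(f \<otimes>\<^bsub>?G\<^esub> inv\<^bsub>?G\<^esub> g) \<otimes>\<^bsub>?G\<^esub> g = f"
    using g by (simp add: m_assoc)
  moreover have "f \<otimes>\<^bsub>?G\<^esub> inv\<^bsub>?G\<^esub> g \<in> carrier ?G" using g by simp
  ultimately show thesis
    using that[of "f \<otimes>\<^bsub>?G\<^esub> inv\<^bsub>?G\<^esub> g"] by (auto simp: Hom_group_def Hom_iff)
qed

lemma Comp_Plus_Arr:
  "f \<in> Arr \<A> \<Longrightarrow> f' \<in> Arr \<A> \<Longrightarrow> g \<in> Arr \<A> \<Longrightarrow> Dom \<A> f = Dom \<A> f' \<Longrightarrow> Cod \<A> f = Dom \<A> g \<Longrightarrow>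
    Cod \<A> f' = Dom \<A> g \<Longrightarrow> g \<cdot> (f \<boxplus> f') = (g \<cdot> f) \<boxplus> (g \<cdot> f')"
  using Comp_Plus by (auto simp: Hom_iff)

lemma Plus_Comp_Arr:
  "f \<in> Arr \<A> \<Longrightarrow> g \<in> Arr \<A> \<Longrightarrow> g' \<in> Arr \<A> \<Longrightarrow> Cod \<A> f = Dom \<A> g \<Longrightarrow> Cod \<A> f = Dom \<A> g' \<Longrightarrow>
    Cod \<A> g = Cod \<A> g' \<Longrightarrow> (g \<boxplus> g') \<cdot> f = (g \<cdot> f) \<boxplus> (g' \<cdot> f)"
  using Plus_Comp by (auto simp: Hom_iff)

text \<open>Since 0 + 0 = 0, distributivity gives g0 + g0 = g0, and one summand cancels.\<close>

lemma Comp_Zero [simp]: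
  assumes "g \<in> Arr \<A>" "Dom \<A> g = B" "A \<in> Obj \<A>"
  shows "g \<cdot> ZeroMor \<A> A B = ZeroMor \<A> A (Cod \<A> g)"
proof (rule Plus_right_cancel)
  show "(g \<cdot> ZeroMor \<A> A B) \<boxplus> (g \<cdot> ZeroMor \<A> A B) =
      ZeroMor \<A> A (Cod \<A> g) \<boxplus> (g \<cdot> ZeroMor \<A> A B)"
    using assms by (subst Comp_Plus_Arr[symmetric]) auto
qed (use assms in auto)

lemma Zero_Comp [simp]:
  assumes "f \<in> Arr \<A>" "Cod \<A> f = B" "D \<in> Obj \<A>"
  shows "ZeroMor \<A> B D \<cdot> f = ZeroMor \<A> (Dom \<A> f) D"
proof (rule Plus_right_cancel)
  show "(ZeroMor \<A> B D \<cdot> f) \<boxplus> (ZeroMor \<A> B D \<cdot> f) =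
      ZeroMor \<A> (Dom \<A> f) D \<boxplus> (ZeroMor \<A> B D \<cdot> f)"
    using assms by (subst Plus_Comp_Arr[symmetric]) auto
qed (use assms in auto)

lemma is_monoD:
  "is_mono \<A> f \<Longrightarrow> f \<cdot> g = f \<cdot> h \<Longrightarrow> g \<in> Arr \<A> \<Longrightarrow> h \<in> Arr \<A> \<Longrightarrow> Cod \<A> g = Dom \<A> f \<Longrightarrow>
    Cod \<A> h = Dom \<A> f \<Longrightarrow> Dom \<A> g = Dom \<A> h \<Longrightarrow> g = h"
proof -
  assume f: "is_mono \<A> f" "f \<cdot> g = f \<cdot> h" and "g \<in> Arr \<A>" "h \<in> Arr \<A>" "Cod \<A> g = Dom \<A> f"
    "Cod \<A> h = Dom \<A> f" "Dom \<A> g = Dom \<A> h"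
  then have "g \<in> Hom \<A> (Dom \<A> h) (Dom \<A> f)" "h \<in> Hom \<A> (Dom \<A> h) (Dom \<A> f)"
    by (simp_all add: Hom_iff)
  then show ?thesis using f unfolding is_mono_def by blast
qed

lemma is_epiD:
  "is_epi \<A> f \<Longrightarrow> g \<cdot> f = h \<cdot> f \<Longrightarrow> g \<in> Arr \<A> \<Longrightarrow> h \<in> Arr \<A> \<Longrightarrow> Dom \<A> g = Cod \<A> f \<Longrightarrow>
    Dom \<A> h = Cod \<A> f \<Longrightarrow> Cod \<A> g = Cod \<A> h \<Longrightarrow> g = h"
proof -
  assume f: "is_epi \<A> f" "g \<cdot> f = h \<cdot> f" and "g \<in> Arr \<A>" "h \<in> Arr \<A>" "Dom \<A> g = Cod \<A> f"
    "Dom \<A> h = Cod \<A> f" "Cod \<A> g = Cod \<A> h"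
  then have "g \<in> Hom \<A> (Cod \<A> f) (Cod \<A> h)" "h \<in> Hom \<A> (Cod \<A> f) (Cod \<A> h)"
    by (simp_all add: Hom_iff)
  then show ?thesis using f unfolding is_epi_def by blast
qed

lemma is_kernel_mono:
  assumes "is_kernel \<A> k f"
  shows "is_mono \<A> k"
  unfolding is_mono_def
proof (intro conjI allI ballI impI)
  show k: "k \<in> Arr \<A>" using assms by (simp add: is_kernel_def)
  fix W g h
  assume g: "g \<in> Hom \<A> W (Dom \<A> k)" and h: "h \<in> Hom \<A> W (Dom \<A> k)" and eq: "k \<cdot> g = k \<cdot> h"
  have f: "f \<in> Arr \<A>" "Cod \<A> k = Dom \<A> f" "f \<cdot> k = ZeroMor \<A> (Dom \<A> k) (Cod \<A> f)"
    using assms by (auto simp: is_kernel_def)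
  have "f \<cdot> (k \<cdot> g) = ZeroMor \<A> W (Cod \<A> f)"
    using f k g by (subst Comp_assoc_Arr[symmetric]) (auto simp: Hom_iff)
  then have "\<exists>!u. u \<in> Hom \<A> W (Dom \<A> k) \<and> k \<cdot> u = k \<cdot> g"
    using assms g f k unfolding is_kernel_def by (auto simp: Hom_iff)
  then show "g = h" using g h eq by metis
qed

lemma is_cokernel_epi:
  assumes "is_cokernel \<A> c f"
  shows "is_epi \<A> c"
  unfolding is_epi_def
proof (intro conjI allI ballI impI)
  show c: "c \<in> Arr \<A>" using assms by (simp add: is_cokernel_def)
  fix W g h
  assume g: "g \<in> Hom \<A> (Cod \<A> c) W" and h: "h \<in> Hom \<A> (Cod \<A> c) W" and eq: "g \<cdot> c = h \<cdot> c"
  have f: "f \<in> Arr \<A>" "Dom \<A> c = Cod \<A> f" "c \<cdot> f = ZeroMor \<A> (Dom \<A> f) (Cod \<A> c)"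
    using assms by (auto simp: is_cokernel_def)
  have "(g \<cdot> c) \<cdot> f = ZeroMor \<A> (Dom \<A> f) W"
    using f c g by (subst Comp_assoc_Arr) (auto simp: Hom_iff)
  then have "\<exists>!u. u \<in> Hom \<A> (Cod \<A> c) W \<and> u \<cdot> c = g \<cdot> c"
    using assms g f c unfolding is_cokernel_def by (auto simp: Hom_iff)
  then show "g = h" using g h eq by metis
qed

lemma is_kernelE:
  assumes "is_kernel \<A> k f" "f \<cdot> g = ZeroMor \<A> (Dom \<A> g) (Cod \<A> f)" "g \<in> Arr \<A>" "Cod \<A> g = Dom \<A> f"
  obtains u where "u \<in> Arr \<A>" "Dom \<A> u = Dom \<A> g" "Cod \<A> u = Dom \<A> k" "k \<cdot> u = g"
proof -
  have "g \<in> Hom \<A> (Dom \<A> g) (Dom \<A> f)" using assms by (simp add: Hom_iff)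
  then show thesis using assms(1,2) that unfolding is_kernel_def by (metis Hom_iff)
qed

lemma is_cokernelE:
  assumes "is_cokernel \<A> c f" "g \<cdot> f = ZeroMor \<A> (Dom \<A> f) (Cod \<A> g)" "g \<in> Arr \<A>" "Dom \<A> g = Cod \<A> f"
  obtains u where "u \<in> Arr \<A>" "Dom \<A> u = Cod \<A> c" "Cod \<A> u = Cod \<A> g" "u \<cdot> c = g"
proof -
  have "g \<in> Hom \<A> (Cod \<A> f) (Cod \<A> g)" using assms by (simp add: Hom_iff)
  then show thesis using assms(1,2) that unfolding is_cokernel_def by (metis Hom_iff)
qed

lemma is_pushoutE:
  assumes "is_pushout \<A> f g f' g'" "a \<cdot> f = b \<cdot> g" "a \<in> Arr \<A>" "b \<in> Arr \<A>"
    "Dom \<A> a = Cod \<A> f" "Dom \<A> b = Cod \<A> g" "Cod \<A> a = Cod \<A> b"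
  obtains u where "u \<in> Arr \<A>" "Dom \<A> u = Cod \<A> f'" "Cod \<A> u = Cod \<A> b" "u \<cdot> f' = a" "u \<cdot> g' = b"
proof -
  have "a \<in> Hom \<A> (Cod \<A> f) (Cod \<A> b)" "b \<in> Hom \<A> (Cod \<A> g) (Cod \<A> b)"
    using assms by (simp_all add: Hom_iff)
  then have "\<exists>!u. u \<in> Hom \<A> (Cod \<A> f') (Cod \<A> b) \<and> u \<cdot> f' = a \<and> u \<cdot> g' = b"
    using assms(1,2) unfolding is_pushout_def by blast
  then show thesis using that by (auto simp: Hom_iff)
qed

text \<open>The uniqueness half of the universal property, in the form in which commutativity of
  squares out of a push-out is tested later.\<close>

lemma is_pushout_cancel:
  assumes po: "is_pushout \<A> f g f' g'" and eq: "v \<cdot> f' = w \<cdot> f'" "v \<cdot> g' = w \<cdot> g'"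
    and vw: "v \<in> Arr \<A>" "w \<in> Arr \<A>" "Dom \<A> v = Cod \<A> f'" "Dom \<A> w = Cod \<A> f'" "Cod \<A> v = Cod \<A> w"
  shows "v = w"
proof -
  have t: "f \<in> Arr \<A>" "g \<in> Arr \<A>" "f' \<in> Arr \<A>" "g' \<in> Arr \<A>" "Dom \<A> f = Dom \<A> g"
    "Dom \<A> f' = Cod \<A> f" "Dom \<A> g' = Cod \<A> g" "Cod \<A> f' = Cod \<A> g'" "f' \<cdot> f = g' \<cdot> g"
    using po by (auto simp: is_pushout_def)
  have "(v \<cdot> f') \<cdot> f = (v \<cdot> g') \<cdot> g" using t vw by (simp add: Comp_assoc_Arr)
  moreover have "v \<cdot> f' \<in> Hom \<A> (Cod \<A> f) (Cod \<A> v)" "v \<cdot> g' \<in> Hom \<A> (Cod \<A> g) (Cod \<A> v)"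
    using t vw by (auto simp: Hom_iff)
  ultimately have "\<exists>!u. u \<in> Hom \<A> (Cod \<A> f') (Cod \<A> v) \<and> u \<cdot> f' = v \<cdot> f' \<and> u \<cdot> g' = v \<cdot> g'"
    using po unfolding is_pushout_def by blast
  then show ?thesis using vw eq unfolding Hom_iff by metis
qed

end

section \<open>Push-outs along monomorphisms\<close>

context abelian_category
begin

text \<open>By normality \<open>m\<close> is the kernel of some \<open>g\<close>, and
  \<open>g\<close> factors through the cokernel \<open>c\<close>. Hence whatever \<open>c\<close>
  kills is killed by \<open>g\<close> and factors uniquely through \<open>m\<close>.\<close>

lemma is_kernel_if_mono:
  assumes "is_mono \<A> m" "is_cokernel \<A> c m"
  shows "is_kernel \<A> m c"
proof -
  have t: "m \<in> Arr \<A>" "c \<in> Arr \<A>" "Dom \<A> c = Cod \<A> m" "c \<cdot> m = ZeroMor \<A> (Dom \<A> m) (Cod \<A> c)"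
    using assms by (auto simp: is_cokernel_def)
  obtain g where g: "is_kernel \<A> m g" using mono_normal assms by blast
  then have g': "g \<in> Arr \<A>" "Cod \<A> m = Dom \<A> g" "g \<cdot> m = ZeroMor \<A> (Dom \<A> m) (Cod \<A> g)"
    by (auto simp: is_kernel_def)
  obtain u where u: "u \<in> Arr \<A>" "Dom \<A> u = Cod \<A> c" "Cod \<A> u = Cod \<A> g" "u \<cdot> c = g"
    using is_cokernelE[OF assms(2), of g] g' by metis
  have "\<exists>!v. v \<in> Hom \<A> W (Dom \<A> m) \<and> m \<cdot> v = x"
    if "x \<in> Hom \<A> W (Dom \<A> c)" "c \<cdot> x = ZeroMor \<A> W (Cod \<A> c)" for x W
  proof -
    have x: "x \<in> Arr \<A>" "Dom \<A> x = W" "Cod \<A> x = Dom \<A> c" using that by (auto simp: Hom_iff)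
    have "g \<cdot> x = u \<cdot> (c \<cdot> x)" using u x t by (simp add: Comp_assoc_Arr[symmetric])
    also have "\<dots> = ZeroMor \<A> W (Cod \<A> g)" using u x t that by (auto)
    finally show ?thesis using g x t g' unfolding is_kernel_def by (auto simp: Hom_iff)
  qed
  then show ?thesis using t by (auto simp: is_kernel_def)
qed

text \<open>The push-out is the cokernel \<open>q\<close> of \<open>w = (g, -i)\<close> into the
  biproduct. The second component of \<open>w\<close> is monic, so \<open>w\<close> is monic and
  therefore the kernel of \<open>q\<close>; this is what makes \<open>i'\<close> monic.\<close>

lemma ex_pushout_along_mono:
  assumes i: "is_mono \<A> i" and g: "g \<in> Arr \<A>" "Dom \<A> g = Dom \<A> i"
  obtains u i' where "is_pushout \<A> i g u i'" "is_mono \<A> i'"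
proof -
  have iA: "i \<in> Arr \<A>" using i by (simp add: is_mono_def)
  obtain S i1 i2 p1 p2 where S: "is_biproduct \<A> (Cod \<A> g) (Cod \<A> i) S i1 i2 p1 p2"
    using ex_biproduct[of "Cod \<A> g" "Cod \<A> i"] g iA by auto
  have b: "i1 \<in> Arr \<A>" "i2 \<in> Arr \<A>" "p1 \<in> Arr \<A>" "p2 \<in> Arr \<A>"
    "Dom \<A> i1 = Cod \<A> g" "Cod \<A> i1 = S" "Dom \<A> i2 = Cod \<A> i" "Cod \<A> i2 = S"
    "Dom \<A> p1 = S" "Cod \<A> p1 = Cod \<A> g" "Dom \<A> p2 = S" "Cod \<A> p2 = Cod \<A> i"
    and r: "p1 \<cdot> i1 = Ident \<A> (Cod \<A> g)" "p2 \<cdot> i2 = Ident \<A> (Cod \<A> i)"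
    "p1 \<cdot> i2 = ZeroMor \<A> (Cod \<A> i) (Cod \<A> g)" "p2 \<cdot> i1 = ZeroMor \<A> (Cod \<A> g) (Cod \<A> i)"
    "(i1 \<cdot> p1) \<boxplus> (i2 \<cdot> p2) = Ident \<A> S"
    using S by (auto simp: is_biproduct_def Hom_iff)
  \<comment> \<open>\<open>n\<close> plays the role of \<open>-i\<close>.\<close>
  obtain n where n: "n \<in> Arr \<A>" "Dom \<A> n = Dom \<A> i" "Cod \<A> n = Cod \<A> i"
    "n \<boxplus> i = ZeroMor \<A> (Dom \<A> i) (Cod \<A> i)"
    using ex_difference[of "ZeroMor \<A> (Dom \<A> i) (Cod \<A> i)" i] iA by auto
  define w where "w = (i1 \<cdot> g) \<boxplus> (i2 \<cdot> n)"
  have w: "w \<in> Arr \<A>" "Dom \<A> w = Dom \<A> i" "Cod \<A> w = S"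
    unfolding w_def using b n g iA by auto
  \<comment> \<open>\<open>n\<close> has trivial kernel: from \<open>n + i = 0\<close> it follows
    that \<open>i \<cdot> z\<close> vanishes together with \<open>n \<cdot> z\<close>, and
    \<open>i\<close> is monic.\<close>
  have zero_if: "z = ZeroMor \<A> (Dom \<A> z) (Dom \<A> i)"
    if "n \<cdot> z = ZeroMor \<A> (Dom \<A> z) (Cod \<A> i)" "z \<in> Arr \<A>" "Cod \<A> z = Dom \<A> i" for z
  proof (rule is_monoD[OF i])
    have "(n \<boxplus> i) \<cdot> z = (n \<cdot> z) \<boxplus> (i \<cdot> z)"
      using that n iA by (subst Plus_Comp_Arr) (simp_all del: n(4))
    then show "i \<cdot> z = i \<cdot> ZeroMor \<A> (Dom \<A> z) (Dom \<A> i)"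
      using that n iA by simp
  qed (use that iA in auto)
  have p2w: "p2 \<cdot> w = n"
    unfolding w_def using b r n g iA
    by (simp add: Comp_Plus_Arr Comp_assoc_Arr[symmetric])
  have w_mono: "is_mono \<A> w"
    unfolding is_mono_def
  proof (intro conjI allI ballI impI)
    fix W x y assume "x \<in> Hom \<A> W (Dom \<A> w)" "y \<in> Hom \<A> W (Dom \<A> w)" and eq: "w \<cdot> x = w \<cdot> y"
    then have xy: "x \<in> Arr \<A>" "y \<in> Arr \<A>" "Dom \<A> x = W" "Dom \<A> y = W" "Cod \<A> x = Dom \<A> i" "Cod \<A> y = Dom \<A> i" "W \<in> Obj \<A>"
      using w by (auto simp: Hom_iff)
    have nn: "n \<cdot> x = n \<cdot> y"
      using arg_cong[OF eq, of "\<lambda>t. p2 \<cdot> t"] xy w b p2w by (simp add: Comp_assoc_Arr[symmetric])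
    obtain z where z: "z \<in> Arr \<A>" "Dom \<A> z = Dom \<A> y" "Cod \<A> z = Cod \<A> y" "z \<boxplus> y = x"
      using ex_difference[of x y] xy by auto
    have "n \<cdot> z = ZeroMor \<A> W (Cod \<A> i)"
    proof (rule Plus_right_cancel)
      show "(n \<cdot> z) \<boxplus> (n \<cdot> y) = ZeroMor \<A> W (Cod \<A> i) \<boxplus> (n \<cdot> y)"
        using nn z xy n iA by (subst Comp_Plus_Arr[symmetric]) simp_all
    qed (use xy z(1-3) n iA in simp_all)
    then have "z = ZeroMor \<A> W (Dom \<A> i)" using zero_if[of z] z(1-3) xy by simp
    then show "x = y" using z xy by simp
  qed (use w in auto)
  obtain q where q: "is_cokernel \<A> q w" using ex_cokernel w by blast
  then have q': "q \<in> Arr \<A>" "Dom \<A> q = S" "q \<cdot> w = ZeroMor \<A> (Dom \<A> i) (Cod \<A> q)"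
    using w by (auto simp: is_cokernel_def)
  have kw: "is_kernel \<A> w q" using is_kernel_if_mono w_mono q by blast
  let ?u = "q \<cdot> i2" and ?i' = "q \<cdot> i1"
  have comm: "?u \<cdot> i = ?i' \<cdot> g"
  proof (rule Plus_right_cancel)
    have "(?u \<cdot> i) \<boxplus> (?u \<cdot> n) = ?u \<cdot> (i \<boxplus> n)"
      using b q' n iA by (simp add: Comp_Plus_Arr)
    also have "\<dots> = ZeroMor \<A> (Dom \<A> i) (Cod \<A> q)"
      using b q' n iA by (simp add: Plus_commute[of i n])
    also have "\<dots> = (?i' \<cdot> g) \<boxplus> (?u \<cdot> n)"
      using b q' n iA g by (simp flip: q'(3) add: w_def Comp_Plus_Arr Comp_assoc_Arr)
    finally show "(?u \<cdot> i) \<boxplus> (?u \<cdot> n) = (?i' \<cdot> g) \<boxplus> (?u \<cdot> n)" .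
  qed (use b q' n iA g in auto)
  have "\<exists>!v. v \<in> Hom \<A> (Cod \<A> ?u) W \<and> v \<cdot> ?u = a \<and> v \<cdot> ?i' = c"
    if "a \<in> Hom \<A> (Cod \<A> i) W" "c \<in> Hom \<A> (Cod \<A> g) W" "a \<cdot> i = c \<cdot> g" for a c W
  proof -
    have ac: "a \<in> Arr \<A>" "c \<in> Arr \<A>" "Dom \<A> a = Cod \<A> i" "Dom \<A> c = Cod \<A> g" "Cod \<A> a = W" "Cod \<A> c = W"
      using that by (auto simp: Hom_iff)
    \<comment> \<open>The morphism given by \<open>c\<close> and \<open>a\<close> on the two
      summands kills \<open>w\<close>, because
      \<open>c \<cdot> g + a \<cdot> n = a \<cdot> (i + n) = 0\<close>; hence it descends to the
      cokernel.\<close>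
    let ?t = "(c \<cdot> p1) \<boxplus> (a \<cdot> p2)"
    have t: "?t \<in> Arr \<A>" "Dom \<A> ?t = S" "Cod \<A> ?t = W" using ac b by auto
    have ti: "?t \<cdot> i1 = c" "?t \<cdot> i2 = a"
      using ac b r g iA by (simp_all add: Plus_Comp_Arr Comp_assoc_Arr)
    have "?t \<cdot> w = (c \<cdot> g) \<boxplus> (a \<cdot> n)"
      unfolding w_def using ti t b n g iA by (simp add: Comp_Plus_Arr Comp_assoc_Arr[symmetric])
    also have "\<dots> = a \<cdot> (i \<boxplus> n)" using that ac n iA by (simp add: Comp_Plus_Arr)
    also have "\<dots> = ZeroMor \<A> (Dom \<A> w) (Cod \<A> ?t)"
      using ac n iA t w by (simp add: Plus_commute[of i n])
    finally obtain v where v: "v \<in> Arr \<A>" "Dom \<A> v = Cod \<A> q" "Cod \<A> v = Cod \<A> ?t" "v \<cdot> q = ?t"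
      using is_cokernelE[OF q, of ?t] t w by metis
    show ?thesis
    proof (rule ex1I[of _ v])
      have "v \<cdot> ?u = a" "v \<cdot> ?i' = c" using v q' b ti by (simp_all add: Comp_assoc_Arr[symmetric])
      then show "v \<in> Hom \<A> (Cod \<A> ?u) W \<and> v \<cdot> ?u = a \<and> v \<cdot> ?i' = c"
        using v t q' b by (auto simp: Hom_iff)
    next
      fix v' assume "v' \<in> Hom \<A> (Cod \<A> ?u) W \<and> v' \<cdot> ?u = a \<and> v' \<cdot> ?i' = c"
      then have v': "v' \<in> Arr \<A>" "Dom \<A> v' = Cod \<A> q" "Cod \<A> v' = W" "v' \<cdot> ?u = a" "v' \<cdot> ?i' = c"
        using q' b by (auto simp: Hom_iff)
      have "v' \<cdot> q = (v' \<cdot> q) \<cdot> Ident \<A> S" using v' q' by simp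
      also have "\<dots> = ((v' \<cdot> ?i') \<cdot> p1) \<boxplus> ((v' \<cdot> ?u) \<cdot> p2)"
        unfolding r(5)[symmetric] using v'(1-3) q' b by (simp add: Comp_Plus_Arr Comp_assoc_Arr)
      finally have "v' \<cdot> q = v \<cdot> q" using v v' by simp
      then show "v' = v"
        by (rule is_epiD[OF is_cokernel_epi[OF q]]) (use v v' t in auto)
    qed
  qed
  then have po: "is_pushout \<A> i g ?u ?i'"
    unfolding is_pushout_def using comm iA g b q' by auto
  have "is_mono \<A> ?i'"
    unfolding is_mono_def
  proof (intro conjI allI ballI impI)
    fix W x y assume "x \<in> Hom \<A> W (Dom \<A> ?i')" "y \<in> Hom \<A> W (Dom \<A> ?i')" and eq: "?i' \<cdot> x = ?i' \<cdot> y"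
    then have xy: "x \<in> Arr \<A>" "y \<in> Arr \<A>" "Dom \<A> x = W" "Dom \<A> y = W" "Cod \<A> x = Cod \<A> g" "Cod \<A> y = Cod \<A> g" "W \<in> Obj \<A>"
      using b q' by (auto simp: Hom_iff)
    obtain z where z: "z \<in> Arr \<A>" "Dom \<A> z = Dom \<A> y" "Cod \<A> z = Cod \<A> y" "z \<boxplus> y = x"
      using ex_difference[of x y] xy by auto
    have "?i' \<cdot> z = ZeroMor \<A> W (Cod \<A> q)"
    proof (rule Plus_right_cancel)
      show "(?i' \<cdot> z) \<boxplus> (?i' \<cdot> y) = ZeroMor \<A> W (Cod \<A> q) \<boxplus> (?i' \<cdot> y)"
        using eq z xy b q' by (subst Comp_Plus_Arr[symmetric]) simp_all
    qed (use xy z(1-3) b q' in simp_all)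
    \<comment> \<open>As \<open>q\<close> kills \<open>i1 \<cdot> z\<close>, this morphism is
      \<open>w \<cdot> s\<close> for some \<open>s\<close>. Its second component
      \<open>n \<cdot> s\<close> is zero, so \<open>s\<close> is zero, and the first component then
      gives \<open>z = 0\<close>.\<close>
    then have "q \<cdot> (i1 \<cdot> z) = ZeroMor \<A> (Dom \<A> (i1 \<cdot> z)) (Cod \<A> q)"
      using z xy b q' by (simp add: Comp_assoc_Arr)
    then obtain s where s: "s \<in> Arr \<A>" "Dom \<A> s = W" "Cod \<A> s = Dom \<A> i" "w \<cdot> s = i1 \<cdot> z"
      using is_kernelE[OF kw, of "i1 \<cdot> z"] z(1-3) xy b(1-6) q'(1,2) w by (metis Cod_Comp Comp_Arr Dom_Comp)
    have "n \<cdot> s = (p2 \<cdot> w) \<cdot> s" by (simp add: p2w)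
    also have "\<dots> = p2 \<cdot> (i1 \<cdot> z)"
      using s w b by (simp add: Comp_assoc_Arr)
    also have "\<dots> = ZeroMor \<A> W (Cod \<A> i)"
      using z xy b r iA g by (simp add: Comp_assoc_Arr[symmetric])
    finally have "s = ZeroMor \<A> W (Dom \<A> i)" using zero_if[of s] s by auto
    then have "i1 \<cdot> z = ZeroMor \<A> W S" using s w xy by auto
    then have "p1 \<cdot> (i1 \<cdot> z) = ZeroMor \<A> W (Cod \<A> g)" using b xy by auto
    then have "z = ZeroMor \<A> W (Cod \<A> g)"
      using z xy b r by (simp add: Comp_assoc_Arr[symmetric])
    then show "x = y" using z xy by simp
  qed (use b q' in auto)
  then show thesis using po that by blast
qed

end

section \<open>Conflations and chain maps\<close>

context extension_closed_subcategory
begin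

lemma conflationD:
  assumes "conflation \<A> \<C> i p"
  shows "i \<in> Arr \<A>" "p \<in> Arr \<A>" "Cod \<A> i = Dom \<A> p" "Dom \<A> i \<in> \<C>" "Dom \<A> p \<in> \<C>" "Cod \<A> p \<in> \<C>"
    "p \<cdot> i = ZeroMor \<A> (Dom \<A> i) (Cod \<A> p)" "is_mono \<A> i" "is_epi \<A> p" "is_cokernel \<A> p i"
    "is_kernel \<A> i p"
  using assms is_kernel_mono is_cokernel_epi
  by (auto simp: conflation_def short_exact_def is_kernel_def)

lemma sub_ObjD [simp]: "A \<in> \<C> \<Longrightarrow> A \<in> Obj \<A>"
  using sub_Obj by auto

lemma conflationI:
  "is_mono \<A> i \<Longrightarrow> is_cokernel \<A> p i \<Longrightarrow> Dom \<A> i \<in> \<C> \<Longrightarrow> Cod \<A> p \<in> \<C> \<Longrightarrow> conflation \<A> \<C> i p"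
  using is_kernel_if_mono extension_closed by (auto simp: conflation_def short_exact_def)

text \<open>The deflation \<open>p'\<close> is induced by \<open>p\<close> and zero. If
  \<open>x\<close> kills \<open>i'\<close>, then \<open>x \<cdot> u\<close> kills \<open>i\<close>
  and equals some \<open>y \<cdot> p\<close>; that \<open>y \<cdot> p' = x\<close> is tested on both
  legs of the push-out. Extension closure places the middle term in the subcategory.\<close>

lemma pushout_conflation:
  assumes c: "conflation \<A> \<C> i p" and po: "is_pushout \<A> i g u i'" and g: "Cod \<A> g \<in> \<C>"
  obtains p' where "conflation \<A> \<C> i' p'" "p' \<cdot> u = p" "Cod \<A> p' = Cod \<A> p"
proof -
  note i = conflationD[OF c]
  have t: "g \<in> Arr \<A>" "u \<in> Arr \<A>" "i' \<in> Arr \<A>" "Dom \<A> g = Dom \<A> i" "Dom \<A> u = Cod \<A> i"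
    "Dom \<A> i' = Cod \<A> g" "Cod \<A> u = Cod \<A> i'" "u \<cdot> i = i' \<cdot> g"
    using po by (auto simp: is_pushout_def)
  obtain p' where p': "p' \<in> Arr \<A>" "Dom \<A> p' = Cod \<A> u" "Cod \<A> p' = Cod \<A> p" "p' \<cdot> u = p"
    "p' \<cdot> i' = ZeroMor \<A> (Cod \<A> g) (Cod \<A> p)"
    using is_pushoutE[OF po, of p "ZeroMor \<A> (Cod \<A> g) (Cod \<A> p)"] i t g by auto
  have "\<exists>!y. y \<in> Hom \<A> (Cod \<A> p') W \<and> y \<cdot> p' = x"
    if "x \<in> Hom \<A> (Cod \<A> i') W" "x \<cdot> i' = ZeroMor \<A> (Dom \<A> i') W" for x W
  proof -
    have x: "x \<in> Arr \<A>" "Dom \<A> x = Cod \<A> i'" "Cod \<A> x = W" using that by (auto simp: Hom_iff)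
    have W: "W \<in> Obj \<A>" using x by auto
    have "(x \<cdot> u) \<cdot> i = (x \<cdot> i') \<cdot> g" using x t i(1-3) by (simp add: Comp_assoc_Arr)
    also have "\<dots> = ZeroMor \<A> (Dom \<A> i) W" using that t W by simp
    finally obtain y where y: "y \<in> Arr \<A>" "Dom \<A> y = Cod \<A> p" "Cod \<A> y = W" "y \<cdot> p = x \<cdot> u"
      using is_cokernelE[OF i(10), of "x \<cdot> u"] x t i(1-3) by (metis Cod_Comp Comp_Arr Dom_Comp)
    have "y \<cdot> p' = x"
    proof (rule is_pushout_cancel[OF po])
      show "(y \<cdot> p') \<cdot> u = x \<cdot> u" using y p' t by (simp add: Comp_assoc_Arr)
      show "(y \<cdot> p') \<cdot> i' = x \<cdot> i'" using y p' t that i W g by (simp add: Comp_assoc_Arr)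
    qed (use x y t p' in auto)
    show ?thesis
    proof (rule ex1I[of _ y])
      show "y \<in> Hom \<A> (Cod \<A> p') W \<and> y \<cdot> p' = x" using y p' \<open>y \<cdot> p' = x\<close> by (auto simp: Hom_iff)
    next
      fix z assume z: "z \<in> Hom \<A> (Cod \<A> p') W \<and> z \<cdot> p' = x"
      then have "z \<cdot> p = y \<cdot> p"
        using Comp_assoc_Arr[of u p' z] y p' t by (auto simp: Hom_iff)
      then show "z = y" by (rule is_epiD[OF i(9)]) (use z y p' in \<open>auto simp: Hom_iff\<close>)
    qed
  qed
  then have cok: "is_cokernel \<A> p' i'" using t p' i by (auto simp: is_cokernel_def)
  \<comment> \<open>The given push-out is arbitrary, so monicity of \<open>i'\<close> is borrowed
    from the explicit one: its leg \<open>i0\<close> is monic and factors as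
    \<open>v \<cdot> i'\<close>.\<close>
  obtain u0 i0 where po0: "is_pushout \<A> i g u0 i0" and m0: "is_mono \<A> i0"
    using ex_pushout_along_mono[OF i(8), of g] t by auto
  have t0: "u0 \<in> Arr \<A>" "i0 \<in> Arr \<A>" "Dom \<A> u0 = Cod \<A> i"
    "Dom \<A> i0 = Cod \<A> g" "Cod \<A> u0 = Cod \<A> i0" "u0 \<cdot> i = i0 \<cdot> g"
    using po0 by (auto simp: is_pushout_def)
  obtain v where v: "v \<in> Arr \<A>" "Dom \<A> v = Cod \<A> u" "Cod \<A> v = Cod \<A> i0" "v \<cdot> i' = i0"
    using is_pushoutE[OF po, of u0 i0] t0 by metis
  have "is_mono \<A> i'"
    unfolding is_mono_def
  proof (intro conjI allI ballI impI)
    fix W x y assume "x \<in> Hom \<A> W (Dom \<A> i')" "y \<in> Hom \<A> W (Dom \<A> i')" and eq: "i' \<cdot> x = i' \<cdot> y"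
    then have xy: "x \<in> Arr \<A>" "y \<in> Arr \<A>" "Dom \<A> x = W" "Dom \<A> y = W" "Cod \<A> x = Dom \<A> i'" "Cod \<A> y = Dom \<A> i'"
      by (auto simp: Hom_iff)
    have "(v \<cdot> i') \<cdot> x = (v \<cdot> i') \<cdot> y" using xy t v(1-3) eq by (simp add: Comp_assoc_Arr)
    then show "x = y" unfolding v(4) by (rule is_monoD[OF m0]) (use xy t t0 in auto)
  qed (use t in auto)
  then have "conflation \<A> \<C> i' p'" using conflationI cok g t i p' by auto
  then show thesis using that p' by auto
qed

end

section \<open>Chain maps between lists of morphisms\<close>

context
  fixes \<A> :: "('o, 'm) ab_cat" (structure)
begin

definition comm_square :: "'m \<Rightarrow> 'm \<Rightarrow> 'm \<Rightarrow> 'm \<Rightarrow> bool" where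
  "comm_square b c d e \<longleftrightarrow> b \<in> Arr \<A> \<and> c \<in> Arr \<A> \<and> d \<in> Arr \<A> \<and> e \<in> Arr \<A> \<and>
     Dom \<A> b = Dom \<A> d \<and> Cod \<A> b = Dom \<A> e \<and> Dom \<A> c = Cod \<A> d \<and> Cod \<A> c = Cod \<A> e \<and> c \<cdot> d = e \<cdot> b"

text \<open>Only the end components, \<open>b\<close> on the left and \<open>a\<close> on the right,
  are named; the inner ones are hidden in existential quantifiers. Composition, splicing and
  reversal thus become inductions along the lists. The indexed families of \<open>ext_step\<close>
  are matched with this form later.\<close>

fun seq_map :: "'m \<Rightarrow> 'm \<Rightarrow> 'm list \<Rightarrow> 'm list \<Rightarrow> bool" where
  "seq_map b a [] [] \<longleftrightarrow> b = a \<and> a \<in> Arr \<A>"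
| "seq_map b a (d # ds) (e # es) \<longleftrightarrow> (\<exists>c. comm_square b c d e \<and> seq_map c a ds es)"
| "seq_map b a _ _ \<longleftrightarrow> False"

end

lemma seq_map_length: "seq_map \<A> b a ds es \<Longrightarrow> length ds = length es"
  by (induction b a ds es rule: seq_map.induct) auto

lemma seq_map_Arr: "seq_map \<A> b a ds es \<Longrightarrow> b \<in> Arr \<A> \<and> a \<in> Arr \<A>"
  by (induction b a ds es rule: seq_map.induct) (auto simp: comm_square_def)

lemma seq_map_Dom_Cod_hd:
  "seq_map \<A> b a ds es \<Longrightarrow> ds \<noteq> [] \<Longrightarrow> Dom \<A> b = Dom \<A> (hd ds) \<and> Cod \<A> b = Dom \<A> (hd es)"
  by (cases "(b, a, ds, es)" rule: seq_map.cases) (auto simp: comm_square_def)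

lemma seq_map_Dom_Cod_last:
  "seq_map \<A> b a ds es \<Longrightarrow> ds \<noteq> [] \<Longrightarrow> Dom \<A> a = Cod \<A> (last ds) \<and> Cod \<A> a = Cod \<A> (last es)"
proof (induction b a ds es rule: seq_map.induct)
  case (2 b a d ds e es)
  then obtain c where c: "comm_square \<A> b c d e" "seq_map \<A> c a ds es" by auto
  show ?case
  proof (cases "ds = []")
    case True
    then have "es = []" "c = a" using c(2) seq_map_length[OF c(2)] by auto
    then show ?thesis using c(1) True by (simp add: comm_square_def)
  next
    case False
    then have "es \<noteq> []" using seq_map_length[OF c(2)] by auto
    then show ?thesis using False 2(1)[OF c(2) False] by simp
  qed
qed auto

lemma seq_map_append_singleton:
  "length ds = length es \<Longrightarrow> seq_map \<A> b a (ds @ [d]) (es @ [e]) \<longleftrightarrow>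
     (\<exists>c. seq_map \<A> b c ds es \<and> comm_square \<A> c a d e)"
proof (induction ds es arbitrary: b rule: list_induct2)
  case Nil
  then show ?case by (auto simp: comm_square_def)
next
  case (Cons x xs y ys)
  then show ?case by auto
qed

lemma (in category) seq_map_Comp:
  "seq_map \<A> b a ds es \<Longrightarrow> seq_map \<A> b' a' es fs \<Longrightarrow> Cod \<A> b = Dom \<A> b' \<Longrightarrow>
    seq_map \<A> (b' \<cdot> b) (a' \<cdot> a) ds fs"
proof (induction ds arbitrary: b b' es fs)
  case Nil
  then show ?case by (cases es; cases fs) auto
next
  case (Cons d ds)
  obtain e es' where es: "es = e # es'" using Cons.prems by (cases es) auto
  obtain f fs' where fs: "fs = f # fs'" using Cons.prems es by (cases fs) auto
  obtain c where c: "comm_square \<A> b c d e" "seq_map \<A> c a ds es'" using Cons.prems es by auto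
  obtain c' where c': "comm_square \<A> b' c' e f" "seq_map \<A> c' a' es' fs'" using Cons.prems es fs by auto
  have cc: "Cod \<A> c = Dom \<A> c'" using c c' by (auto simp: comm_square_def)
  have "(c' \<cdot> c) \<cdot> d = c' \<cdot> (e \<cdot> b)" using c c' by (simp add: comm_square_def Comp_assoc_Arr)
  also have "\<dots> = f \<cdot> (b' \<cdot> b)"
    using c c' by (auto simp: comm_square_def Comp_assoc_Arr[symmetric])
  finally have "comm_square \<A> (b' \<cdot> b) (c' \<cdot> c) d f"
    using c c' by (simp add: comm_square_def)
  then show ?case using Cons.IH[OF c(2) c'(2) cc] es fs by auto
qed

text \<open>The homotopy \<open>s\<close> is subtracted: the left component
  \<open>s \<cdot> d\<close> becomes zero and the next one \<open>c\<close> becomes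
  \<open>f = c - e \<cdot> s\<close>. The square after that still commutes because
  \<open>e' \<cdot> e = 0\<close>, so all further components are kept.\<close>

lemma (in preadditive_category) seq_map_left_homotopy:
  assumes m: "seq_map \<A> b a (d # d' # ds) (e # e' # es)"
    and b: "b = s \<cdot> d" "s \<in> Arr \<A>" "Dom \<A> s = Cod \<A> d" "Cod \<A> s = Dom \<A> e"
    and e: "e' \<cdot> e = ZeroMor \<A> (Dom \<A> e) (Cod \<A> e')"
  shows "seq_map \<A> (ZeroMor \<A> (Dom \<A> d) (Dom \<A> e)) a (d # d' # ds) (e # e' # es)"
proof -
  obtain c c' where c: "comm_square \<A> b c d e" "comm_square \<A> c c' d' e'" "seq_map \<A> c' a ds es"
    using m by auto
  then have t: "b \<in> Arr \<A>" "c \<in> Arr \<A>" "c' \<in> Arr \<A>" "d \<in> Arr \<A>" "e \<in> Arr \<A>" "d' \<in> Arr \<A>" "e' \<in> Arr \<A>"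
    "Cod \<A> d = Dom \<A> d'" "Cod \<A> e = Dom \<A> e'" "Dom \<A> c = Cod \<A> d" "Cod \<A> c = Cod \<A> e"
    "Dom \<A> c' = Cod \<A> d'" "Cod \<A> c' = Cod \<A> e'" "c \<cdot> d = e \<cdot> b" "c' \<cdot> d' = e' \<cdot> c"
    by (auto simp: comm_square_def)
  obtain f where f: "f \<in> Arr \<A>" "Dom \<A> f = Cod \<A> d" "Cod \<A> f = Cod \<A> e" "f \<boxplus> (e \<cdot> s) = c"
    using ex_difference[of c "e \<cdot> s"] t b by auto
  have "f \<cdot> d = ZeroMor \<A> (Dom \<A> d) (Cod \<A> e)"
  proof (rule Plus_right_cancel)
    have "(f \<cdot> d) \<boxplus> (e \<cdot> s \<cdot> d) = (f \<boxplus> (e \<cdot> s)) \<cdot> d"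
      using t b f(1-3) by (simp add: Plus_Comp_Arr Comp_assoc_Arr)
    also have "\<dots> = e \<cdot> s \<cdot> d" using f t b by simp
    finally show "(f \<cdot> d) \<boxplus> (e \<cdot> s \<cdot> d) = ZeroMor \<A> (Dom \<A> d) (Cod \<A> e) \<boxplus> (e \<cdot> s \<cdot> d)"
      using t b by simp
  qed (use t b(2-4) f(1-3) in auto)
  moreover have "e' \<cdot> f = c' \<cdot> d'"
  proof (rule Plus_right_cancel)
    have "(e' \<cdot> f) \<boxplus> (e' \<cdot> e \<cdot> s) = e' \<cdot> c"
      using t b f by (subst Comp_Plus_Arr[symmetric]) simp_all
    moreover have "e' \<cdot> e \<cdot> s = ZeroMor \<A> (Cod \<A> d) (Cod \<A> e')"
      using t b e by (simp add: Comp_assoc_Arr[symmetric])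
    ultimately show "(e' \<cdot> f) \<boxplus> (e' \<cdot> e \<cdot> s) = (c' \<cdot> d') \<boxplus> (e' \<cdot> e \<cdot> s)"
      using t b by simp
  qed (use t b(2-4) f(1-3) in auto)
  ultimately have "comm_square \<A> (ZeroMor \<A> (Dom \<A> d) (Dom \<A> e)) f d e" "comm_square \<A> f c' d' e'"
    using t f(1-3) by (simp_all add: comm_square_def)
  then show ?thesis using c(3) by auto
qed

section \<open>Yoneda extensions\<close>

context extension_closed_subcategory
begin

abbreviation "Seq \<equiv> spliced \<A> (conflation \<A> \<C>)"

lemma SeqD:
  assumes "Seq t A B ds"
  shows "t \<ge> 1" "length ds = t + 1" "A \<in> \<C>" "B \<in> \<C>" "Dom \<A> (hd ds) = B" "Cod \<A> (last ds) = A"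
    "set ds \<subseteq> Arr \<A>"
proof -
  have "t \<ge> 1 \<and> length ds = t + 1 \<and> A \<in> \<C> \<and> B \<in> \<C> \<and> Dom \<A> (hd ds) = B \<and> Cod \<A> (last ds) = A \<and>
    set ds \<subseteq> Arr \<A>"
    using assms
  proof (induction rule: spliced.induct)
    case (splice i p B K t A j ds)
    then show ?case using conflationD[OF splice(1)] by (auto split: if_splits)
  qed (auto dest: conflationD)
  then show "t \<ge> 1" "length ds = t + 1" "A \<in> \<C>" "B \<in> \<C>" "Dom \<A> (hd ds) = B" "Cod \<A> (last ds) = A"
    "set ds \<subseteq> Arr \<A>" by auto
qed

lemma Seq_cases:
  assumes "Seq t A B ds"
  obtains (single) i p where "t = 1" "ds = [i, p]" "conflation \<A> \<C> i p" "Dom \<A> i = B" "Cod \<A> p = A"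
  | (splice) i p j t' ds' where "t = Suc t'" "ds = i # (j \<cdot> p) # ds'" "conflation \<A> \<C> i p"
    "Dom \<A> i = B" "Seq t' A (Cod \<A> p) (j # ds')" "j \<in> Arr \<A>" "Dom \<A> j = Cod \<A> p" "ds' \<noteq> []"
  using assms
proof (cases rule: spliced.cases)
  case (splice i p K t j ds)
  then show ?thesis using that(2)[of t i j p ds] SeqD[of t A K "j # ds"] by fastforce
qed (use that in auto)

text \<open>A common shape for both cases of \<open>Seq_cases\<close>, suited to
  \<open>push_seq\<close>, which alters just the first two morphisms. In degree 1 the morphism
  \<open>e\<close> is the deflation, otherwise it is the splice \<open>j \<cdot> p\<close>, and in
  both cases it kills \<open>d\<close>.\<close>

lemma Seq_first:
  assumes "Seq t A B ds"
  obtains d e ds' p where "ds = d # e # ds'" "conflation \<A> \<C> d p" "Dom \<A> d = B" "e \<in> Arr \<A>"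
    "Dom \<A> e = Cod \<A> d" "e \<cdot> d = ZeroMor \<A> B (Cod \<A> e)"
  using assms
proof (cases rule: Seq_cases)
  case (single i p)
  then show thesis using that[of i p "[]" p] conflationD[of i p] by auto
next
  case (splice i p j t' ds')
  note c = conflationD[OF splice(3)]
  have "(j \<cdot> p) \<cdot> i = ZeroMor \<A> B (Cod \<A> (j \<cdot> p))"
    using splice c by (simp add: Comp_assoc_Arr)
  then show thesis using splice c that[of i "j \<cdot> p" ds' p] by simp
qed

lemma seq_map_splice:
  assumes "comm_square \<A> b c i i'" "comm_square \<A> c k p p'" "seq_map \<A> k a (j # ds) (j' # ds')"
  shows "seq_map \<A> b a (i # (j \<cdot> p) # ds) (i' # (j' \<cdot> p') # ds')"
proof -
  obtain l where l: "comm_square \<A> k l j j'" "seq_map \<A> l a ds ds'" using assms by auto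
  have t: "k \<in> Arr \<A>" "l \<in> Arr \<A>" "c \<in> Arr \<A>" "j \<in> Arr \<A>" "j' \<in> Arr \<A>" "p \<in> Arr \<A>" "p' \<in> Arr \<A>"
    "Cod \<A> p = Dom \<A> j" "Cod \<A> p' = Dom \<A> j'" "Dom \<A> c = Dom \<A> p" "Cod \<A> c = Dom \<A> p'"
    "Dom \<A> k = Dom \<A> j" "Cod \<A> k = Dom \<A> j'" "Dom \<A> l = Cod \<A> j" "Cod \<A> l = Cod \<A> j'"
    "l \<cdot> j = j' \<cdot> k" "k \<cdot> p = p' \<cdot> c"
    using l assms by (auto simp: comm_square_def)
  have "l \<cdot> (j \<cdot> p) = (l \<cdot> j) \<cdot> p" using t(1-15) by (simp add: Comp_assoc_Arr)
  also have "\<dots> = j' \<cdot> (p' \<cdot> c)" using t by (simp add: Comp_assoc_Arr)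
  finally have "comm_square \<A> c l (j \<cdot> p) (j' \<cdot> p')"
    using t by (simp add: comm_square_def Comp_assoc_Arr)
  then show ?thesis using assms(1) l(2) by auto
qed

text \<open>A chain map induces a morphism \<open>k\<close> between the objects at which the
  sequences are spliced: \<open>p' \<cdot> c\<close> kills \<open>i\<close> and so descends along
  \<open>p\<close>. The square of \<open>k\<close> with \<open>j\<close> and \<open>j'\<close>
  commutes because \<open>p\<close> is epic.\<close>

lemma seq_map_unsplice:
  assumes m: "seq_map \<A> b a (i # (j \<cdot> p) # ds) (i' # (j' \<cdot> p') # ds')"
    and c: "conflation \<A> \<C> i p" and c': "conflation \<A> \<C> i' p'"
    and j: "j \<in> Arr \<A>" "Dom \<A> j = Cod \<A> p" "j' \<in> Arr \<A>" "Dom \<A> j' = Cod \<A> p'"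
  obtains c k where "comm_square \<A> b c i i'" "comm_square \<A> c k p p'" "seq_map \<A> k a (j # ds) (j' # ds')"
proof -
  note ip = conflationD[OF c] and ip' = conflationD[OF c']
  obtain c l where s: "comm_square \<A> b c i i'" "comm_square \<A> c l (j \<cdot> p) (j' \<cdot> p')" "seq_map \<A> l a ds ds'"
    using m by auto
  have t: "b \<in> Arr \<A>" "c \<in> Arr \<A>" "l \<in> Arr \<A>" "Dom \<A> b = Dom \<A> i" "Cod \<A> b = Dom \<A> i'"
    "Dom \<A> c = Dom \<A> p" "Cod \<A> c = Dom \<A> p'" "Dom \<A> l = Cod \<A> j" "Cod \<A> l = Cod \<A> j'"
    "c \<cdot> i = i' \<cdot> b" "l \<cdot> (j \<cdot> p) = (j' \<cdot> p') \<cdot> c"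
    using s j ip(1-3) ip'(1-3) by (auto simp: comm_square_def)
  have "(p' \<cdot> c) \<cdot> i = (p' \<cdot> i') \<cdot> b" using t ip(1-3) ip'(1-3) by (simp add: Comp_assoc_Arr)
  also have "\<dots> = ZeroMor \<A> (Dom \<A> i) (Cod \<A> (p' \<cdot> c))" using t ip(1-4) ip'(1-7) by simp
  finally obtain k where k: "k \<in> Arr \<A>" "Dom \<A> k = Cod \<A> p" "Cod \<A> k = Cod \<A> p'" "k \<cdot> p = p' \<cdot> c"
    using is_cokernelE[OF ip(10), of "p' \<cdot> c"] t ip(1-3) ip'(1-3) by (metis Cod_Comp Comp_Arr Dom_Comp)
  have "l \<cdot> j = j' \<cdot> k"
  proof (rule is_epiD[OF ip(9)])
    show "(l \<cdot> j) \<cdot> p = (j' \<cdot> k) \<cdot> p" using t k j ip(1-3) ip'(1-3) by (simp add: Comp_assoc_Arr)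
  qed (use t k j in auto)
  then have "comm_square \<A> k l j j'" "comm_square \<A> c k p p'"
    using t k j ip ip' by (simp_all add: comm_square_def)
  then show thesis using that s by auto
qed

lemma seq_map_refl: "Seq t A B ds \<Longrightarrow> seq_map \<A> (Ident \<A> B) (Ident \<A> A) ds ds"
proof (induction rule: spliced.induct)
  case (single i p B A)
  then show ?case
    using conflationD[of i p] by (auto simp: comm_square_def intro!: exI[of _ "Ident \<A> (Dom \<A> p)"])
next
  case (splice i p B K t A j ds)
  have "comm_square \<A> (Ident \<A> B) (Ident \<A> (Dom \<A> p)) i i"
    "comm_square \<A> (Ident \<A> (Dom \<A> p)) (Ident \<A> K) p p"
    using conflationD[OF splice(1)] splice(2,3) by (auto simp: comm_square_def)
  then show ?case using seq_map_splice splice.IH by blast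
qed

section \<open>Push-outs of sequences\<close>

lemma ex_pushout_conflation:
  assumes "conflation \<A> \<C> i p" "g \<in> Arr \<A>" "Dom \<A> g = Dom \<A> i" "Cod \<A> g \<in> \<C>"
  obtains u i' p' where "is_pushout \<A> i g u i'" "conflation \<A> \<C> i' p'" "p' \<cdot> u = p" "Cod \<A> p' = Cod \<A> p"
proof -
  obtain u i' where "is_pushout \<A> i g u i'"
    using ex_pushout_along_mono[OF conflationD(8)[OF assms(1)]] assms by metis
  then show thesis using that pushout_conflation[OF assms(1) _ assms(4)] by metis
qed

lemma ex_push_seq:
  assumes "Seq t A B ds" "g \<in> Arr \<A>" "Dom \<A> g = B" "Cod \<A> g \<in> \<C>"
  obtains es where "push_seq \<A> g ds es"
proof -
  obtain d e ds' p where d: "ds = d # e # ds'" "conflation \<A> \<C> d p" "Dom \<A> d = B" "e \<in> Arr \<A>"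
    "Dom \<A> e = Cod \<A> d" "e \<cdot> d = ZeroMor \<A> B (Cod \<A> e)"
    using Seq_first assms(1) .
  obtain u d' p' where po: "is_pushout \<A> d g u d'" "conflation \<A> \<C> d' p'"
    using ex_pushout_conflation[OF d(2), of g] assms d by metis
  have t: "Cod \<A> u = Cod \<A> d'" "Dom \<A> d' = Cod \<A> g" using po by (simp_all add: is_pushout_def)
  obtain e' where "e' \<in> Arr \<A>" "Dom \<A> e' = Cod \<A> u" "Cod \<A> e' = Cod \<A> e" "e' \<cdot> u = e"
    "e' \<cdot> d' = ZeroMor \<A> (Cod \<A> g) (Cod \<A> e)"
    using is_pushoutE[OF po(1), of e "ZeroMor \<A> (Cod \<A> g) (Cod \<A> e)"] d assms by auto
  then have "push_seq \<A> g (d # e # ds') (d' # e' # ds')"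
    using po t by (intro push_ext) (simp_all add: Hom_iff)
  then show thesis using that d by auto
qed

lemma push_seq_ConsE:
  assumes "push_seq \<A> g (d # e # ds) es"
  obtains d' u e' where "es = d' # e' # ds" "is_pushout \<A> d g u d'" "e' \<in> Arr \<A>" "Dom \<A> e' = Cod \<A> d'"
    "Cod \<A> e' = Cod \<A> e" "e' \<cdot> u = e" "e' \<cdot> d' = ZeroMor \<A> (Dom \<A> d') (Cod \<A> e)"
  using assms by (cases rule: push_seq.cases) (auto simp: Hom_iff)

text \<open>In \<open>push_seq\<close> the new second morphism is only specified by its composites
  with the two legs of the push-out. Those composites agree with the ones of the deflation from
  \<open>pushout_conflation\<close>, followed by \<open>j\<close> if the sequence is longer, so
  uniqueness identifies the two and the result is again spliced.\<close>

lemma push_seq_Seq: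
  assumes ds: "Seq t A B ds" and push: "push_seq \<A> g ds es" and g: "Cod \<A> g \<in> \<C>"
  shows "Seq t A (Cod \<A> g) es" "seq_map \<A> g (Ident \<A> A) ds es"
proof -
  have "Seq t A (Cod \<A> g) es \<and> seq_map \<A> g (Ident \<A> A) ds es"
    using ds
  proof (cases rule: Seq_cases)
    case (single i p)
    obtain i' u p' where es: "es = [i', p']" and po: "is_pushout \<A> i g u i'" and p': "p' \<in> Arr \<A>"
      "Dom \<A> p' = Cod \<A> i'" "Cod \<A> p' = Cod \<A> p" "p' \<cdot> u = p" "p' \<cdot> i' = ZeroMor \<A> (Dom \<A> i') (Cod \<A> p)"
      using push_seq_ConsE push single(2) by (metis (no_types))
    obtain p'' where p'': "conflation \<A> \<C> i' p''" "p'' \<cdot> u = p" "Cod \<A> p'' = Cod \<A> p"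
      using pushout_conflation[OF single(3) po g] .
    note i = conflationD[OF single(3)] and i' = conflationD[OF p''(1)]
    have "p'' = p'"
      by (rule is_pushout_cancel[OF po]) (use p' p'' i' po in \<open>auto simp: is_pushout_def\<close>)
    moreover have "comm_square \<A> g u i i'" "comm_square \<A> u (Ident \<A> A) p p'"
      using po p' single i by (auto simp: is_pushout_def comm_square_def)
    moreover have "Dom \<A> i' = Cod \<A> g" using po by (simp add: is_pushout_def)
    moreover have "Seq 1 A (Cod \<A> g) [i', p']"
      using calculation p''(1) p'(3) single(5) by (intro spliced.single) simp_all
    moreover have "A \<in> \<C>" using SeqD(3)[OF ds] .
    ultimately show ?thesis using es single(1,2) by auto
  next
    case (splice i p j t' ds')
    obtain i' u e' where es: "es = i' # e' # ds'" and po: "is_pushout \<A> i g u i'" and e': "e' \<in> Arr \<A>"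
      "Dom \<A> e' = Cod \<A> i'" "Cod \<A> e' = Cod \<A> (j \<cdot> p)" "e' \<cdot> u = j \<cdot> p"
      "e' \<cdot> i' = ZeroMor \<A> (Dom \<A> i') (Cod \<A> (j \<cdot> p))"
      using push_seq_ConsE push splice(2) by (metis (no_types))
    obtain p' where p': "conflation \<A> \<C> i' p'" "p' \<cdot> u = p" "Cod \<A> p' = Cod \<A> p"
      using pushout_conflation[OF splice(3) po g] .
    note i = conflationD[OF splice(3)] and i' = conflationD[OF p'(1)]
    have t: "u \<in> Arr \<A>" "Cod \<A> u = Cod \<A> i'" "Dom \<A> u = Cod \<A> i" "g \<in> Arr \<A>" "Dom \<A> g = Dom \<A> i" "Dom \<A> i' = Cod \<A> g"
      "u \<cdot> i = i' \<cdot> g"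
      using po by (auto simp: is_pushout_def)
    have "j \<cdot> p' = e'"
    proof (rule is_pushout_cancel[OF po])
      show "(j \<cdot> p') \<cdot> u = e' \<cdot> u" using e' p' splice t i' by (simp add: Comp_assoc_Arr)
      show "(j \<cdot> p') \<cdot> i' = e' \<cdot> i'" using e' p' splice t i i' by (simp add: Comp_assoc_Arr)
    qed (use e' p' splice t i i' in auto)
    moreover have "comm_square \<A> g u i i'" "comm_square \<A> u (Ident \<A> (Cod \<A> p)) p p'"
      using t p' splice i i' by (auto simp: comm_square_def)
    note seq_map_splice[OF this seq_map_refl[OF splice(5)]]
    ultimately show ?thesis
      using spliced.splice[OF p'(1) t(6) p'(3) splice(5)] by (simp only: es splice(1,2))
  qed
  then show "Seq t A (Cod \<A> g) es" "seq_map \<A> g (Ident \<A> A) ds es" by auto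
qed

text \<open>The universal property of a push-out sequence: the component \<open>c\<close> and
  \<open>x \<cdot> k\<close> agree after restriction and glue to \<open>c'\<close> on the push-out
  object, while the components further right stay as they are.\<close>

lemma seq_map_push_seq:
  assumes ds: "Seq t A B ds" and es: "Seq t A' B' es" and push: "push_seq \<A> g ds ds'"
    and m: "seq_map \<A> (k \<cdot> g) a ds es" and k: "k \<in> Arr \<A>" "Dom \<A> k = Cod \<A> g" "Cod \<A> k = B'"
  shows "seq_map \<A> k a ds' es"
proof -
  obtain d e ds1 p where d: "ds = d # e # ds1" "conflation \<A> \<C> d p" "Dom \<A> d = B" "e \<in> Arr \<A>"
    "Dom \<A> e = Cod \<A> d" "e \<cdot> d = ZeroMor \<A> B (Cod \<A> e)"
    using Seq_first ds .
  obtain x y zs q where x: "es = x # y # zs" "conflation \<A> \<C> x q" "Dom \<A> x = B'" "y \<in> Arr \<A>"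
    "Dom \<A> y = Cod \<A> x" "y \<cdot> x = ZeroMor \<A> B' (Cod \<A> y)"
    using Seq_first es .
  obtain d' u e' where d': "ds' = d' # e' # ds1" and po: "is_pushout \<A> d g u d'" and e': "e' \<in> Arr \<A>"
    "Dom \<A> e' = Cod \<A> d'" "Cod \<A> e' = Cod \<A> e" "e' \<cdot> u = e" "e' \<cdot> d' = ZeroMor \<A> (Dom \<A> d') (Cod \<A> e)"
    using push_seq_ConsE push d(1) by (metis (no_types))
  have t: "g \<in> Arr \<A>" "u \<in> Arr \<A>" "d' \<in> Arr \<A>" "Dom \<A> u = Cod \<A> d" "Dom \<A> g = Dom \<A> d"
    "Dom \<A> d' = Cod \<A> g" "Cod \<A> u = Cod \<A> d'"
    using po by (auto simp: is_pushout_def)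
  have xA: "x \<in> Arr \<A>" using conflationD[OF x(2)] by simp
  obtain c l where s: "comm_square \<A> (k \<cdot> g) c d x" "comm_square \<A> c l e y" "seq_map \<A> l a ds1 zs"
    using m d x by auto
  then have cl: "c \<in> Arr \<A>" "l \<in> Arr \<A>" "Dom \<A> c = Cod \<A> d" "Cod \<A> c = Cod \<A> x" "Dom \<A> l = Cod \<A> e"
    "Cod \<A> l = Cod \<A> y" "c \<cdot> d = x \<cdot> k \<cdot> g" "l \<cdot> e = y \<cdot> c"
    by (auto simp: comm_square_def)
  have "c \<cdot> d = (x \<cdot> k) \<cdot> g" using cl(7) x xA k t by (simp add: Comp_assoc_Arr)
  then obtain c' where c': "c' \<in> Arr \<A>" "Dom \<A> c' = Cod \<A> u" "Cod \<A> c' = Cod \<A> x" "c' \<cdot> u = c" "c' \<cdot> d' = x \<cdot> k"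
    using is_pushoutE[OF po, of c "x \<cdot> k"] cl x xA k t by auto
  have "l \<cdot> e' = y \<cdot> c'"
  proof (rule is_pushout_cancel[OF po])
    show "(l \<cdot> e') \<cdot> u = (y \<cdot> c') \<cdot> u" using c' cl e' t x by (simp add: Comp_assoc_Arr)
    have "(l \<cdot> e') \<cdot> d' = ZeroMor \<A> (Dom \<A> d') (Cod \<A> y)" using cl e' t by (simp add: Comp_assoc_Arr)
    moreover have "(y \<cdot> c') \<cdot> d' = (y \<cdot> x) \<cdot> k" using c' cl k t x(3-5) xA by (simp add: Comp_assoc_Arr)
    ultimately show "(l \<cdot> e') \<cdot> d' = (y \<cdot> c') \<cdot> d'" using x k t by simp
  qed (use c' cl e' t x in auto)
  then have "comm_square \<A> k c' d' x" "comm_square \<A> c' l e' y"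
    using c' cl e' t x xA k by (auto simp: comm_square_def)
  then show ?thesis using s(3) d' x(1) by auto
qed

text \<open>Inflations compose. A morphism killing \<open>j \<cdot> i\<close> induces, after
  \<open>j\<close>, a morphism on the cokernel of \<open>i\<close>, and both together are exactly a
  cocone under \<open>j\<close> and \<open>p\<close>; hence the push-out leg \<open>u\<close> is the
  cokernel of \<open>j \<cdot> i\<close>.\<close>

lemma conflation_Comp:
  assumes ip: "conflation \<A> \<C> i p" and jq: "conflation \<A> \<C> j q" and po: "is_pushout \<A> j p u j'"
    and ij: "Dom \<A> j = Cod \<A> i" and u: "Cod \<A> u \<in> \<C>"
  shows "conflation \<A> \<C> (j \<cdot> i) u"
proof (rule conflationI)
  note i = conflationD[OF ip] and j = conflationD[OF jq]
  have t: "u \<in> Arr \<A>" "j' \<in> Arr \<A>" "Dom \<A> u = Cod \<A> j" "Cod \<A> j' = Cod \<A> u" "Dom \<A> j' = Cod \<A> p"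
    "u \<cdot> j = j' \<cdot> p"
    using po by (simp_all add: is_pushout_def)
  show "is_mono \<A> (j \<cdot> i)"
    unfolding is_mono_def
  proof (intro conjI allI ballI impI)
    fix W x y assume "x \<in> Hom \<A> W (Dom \<A> (j \<cdot> i))" "y \<in> Hom \<A> W (Dom \<A> (j \<cdot> i))"
      and eq: "(j \<cdot> i) \<cdot> x = (j \<cdot> i) \<cdot> y"
    then have xy: "x \<in> Arr \<A>" "y \<in> Arr \<A>" "Dom \<A> x = W" "Dom \<A> y = W" "Cod \<A> x = Dom \<A> i" "Cod \<A> y = Dom \<A> i"
      using i(1) j(1) ij by (simp_all add: Hom_iff)
    have "j \<cdot> (i \<cdot> x) = j \<cdot> (i \<cdot> y)" using eq xy i(1) j(1) ij by (simp add: Comp_assoc_Arr)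
    then have "i \<cdot> x = i \<cdot> y" by (rule is_monoD[OF j(8)]) (use xy i(1) ij in simp_all)
    then show "x = y" by (rule is_monoD[OF i(8)]) (use xy in simp_all)
  qed (use i(1) j(1) ij in simp)
  have "u \<cdot> (j \<cdot> i) = (u \<cdot> j) \<cdot> i" using t(1-3) i(1) j(1) ij by (simp add: Comp_assoc_Arr)
  also have "\<dots> = j' \<cdot> (p \<cdot> i)" using t i(1-3) by (simp add: Comp_assoc_Arr)
  finally have zero: "u \<cdot> (j \<cdot> i) = ZeroMor \<A> (Dom \<A> i) (Cod \<A> u)"
    using t(1-5) i(1-7) by simp
  have "\<exists>!y. y \<in> Hom \<A> (Cod \<A> u) W \<and> y \<cdot> u = x"
    if "x \<in> Hom \<A> (Cod \<A> j) W" "x \<cdot> (j \<cdot> i) = ZeroMor \<A> (Dom \<A> i) W" for x W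
  proof -
    have x: "x \<in> Arr \<A>" "Dom \<A> x = Cod \<A> j" "Cod \<A> x = W" using that by (simp_all add: Hom_iff)
    have "(x \<cdot> j) \<cdot> i = ZeroMor \<A> (Dom \<A> i) W" using that(2) x i(1) j(1) ij by (simp add: Comp_assoc_Arr)
    then obtain y where y: "y \<in> Arr \<A>" "Dom \<A> y = Cod \<A> p" "Cod \<A> y = W" "y \<cdot> p = x \<cdot> j"
      using is_cokernelE[OF i(10), of "x \<cdot> j"] x i(1) j(1) ij by auto
    obtain z where z: "z \<in> Arr \<A>" "Dom \<A> z = Cod \<A> u" "Cod \<A> z = W" "z \<cdot> u = x" "z \<cdot> j' = y"
      using is_pushoutE[OF po, of x y] x y by metis
    show ?thesis
    proof (rule ex1I[of _ z])
      fix z' assume "z' \<in> Hom \<A> (Cod \<A> u) W \<and> z' \<cdot> u = x"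
      then have z': "z' \<in> Arr \<A>" "Dom \<A> z' = Cod \<A> u" "Cod \<A> z' = W" "z' \<cdot> u = x"
        by (simp_all add: Hom_iff)
      have "z' \<cdot> j' = z \<cdot> j'"
      proof (rule is_epiD[OF i(9)])
        have "(z' \<cdot> j') \<cdot> p = (z' \<cdot> u) \<cdot> j" "(z \<cdot> j') \<cdot> p = (z \<cdot> u) \<cdot> j"
          using z(1-3) z'(1-3) t i(2) j(1) by (simp_all add: Comp_assoc_Arr)
        then show "(z' \<cdot> j') \<cdot> p = (z \<cdot> j') \<cdot> p" using z(4) z'(4) by simp
      qed (use z(1-3) z'(1-3) t in simp_all)
      then show "z' = z"
        by (rule is_pushout_cancel[OF po, rotated]) (use z(1-4) z' t in simp_all)
    qed (use z in \<open>simp add: Hom_iff\<close>)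
  qed
  then show "is_cokernel \<A> u (j \<cdot> i)"
    unfolding is_cokernel_def using t i(1-3) j(1-3) ij zero by simp
  show "Dom \<A> (j \<cdot> i) \<in> \<C>" using i(1,4) j(1) ij by simp
qed (rule u)

text \<open>
  If the pull-back of \<open>ds\<close> along \<open>f\<close> vanishes, as witnessed by a chain map, then \<open>ds\<close> is itself a
  pull-back along some \<open>m\<close> such that \<open>m \<cdot> f\<close> is null-homotopic. In the inductive step the first two
  conflations are enlarged by two push-outs so that the obstruction moves one place to the right.
\<close>

lemma pullback_obstruction:
  assumes "Seq t A' B' ds'" "Seq t A B ds" "seq_map \<A> (ZeroMor \<A> B' B) f ds' ds"
  shows "\<exists>M es m v. Seq t M B es \<and> seq_map \<A> (Ident \<A> B) m ds es \<and>
    v \<in> Arr \<A> \<and> Dom \<A> v = A' \<and> Cod \<A> v = Dom \<A> (last es) \<and> m \<cdot> f = last es \<cdot> v"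
  using assms
proof (induction arbitrary: B ds rule: spliced.induct)
  case (single i' p' B' A')
  from single(4) show ?case
  proof (cases rule: Seq_cases)
    case s: (single i p)
    note ip = conflationD[OF s(3)] and ip' = conflationD[OF single(1)]
    have fA: "f \<in> Arr \<A>" using seq_map_Arr[OF single(5)] by simp
    obtain c where "comm_square \<A> (ZeroMor \<A> B' B) c i' i" "comm_square \<A> c f p' p"
      using single(5) s(2) by auto
    then have c: "c \<in> Arr \<A>" "Dom \<A> c = Dom \<A> p'" "Cod \<A> c = Dom \<A> p" "Dom \<A> f = Cod \<A> p'"
      "Cod \<A> f = Cod \<A> p" "f \<cdot> p' = p \<cdot> c" "c \<cdot> i' = i \<cdot> ZeroMor \<A> B' B"
      using ip ip' by (simp_all add: comm_square_def)
    \<comment> \<open>With zero as left component, \<open>c\<close> kills \<open>i'\<close> and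
      descends to \<open>v\<close>; cancelling the epimorphism \<open>p'\<close> yields
      \<open>f = p \<cdot> v\<close>. So \<open>ds\<close> itself with \<open>m\<close> the identity
      is a witness.\<close>
    have "c \<cdot> i' = ZeroMor \<A> (Dom \<A> i') (Cod \<A> c)" using c ip ip' s single(2) by auto
    then obtain v where v: "v \<in> Arr \<A>" "Dom \<A> v = Cod \<A> p'" "Cod \<A> v = Cod \<A> c" "v \<cdot> p' = c"
      using is_cokernelE[OF ip'(10), of c] c ip'(3) by metis
    have "f = p \<cdot> v"
      by (rule is_epiD[OF ip'(9)]) (use c v ip(1-3) ip'(1-3) fA in \<open>simp_all add: Comp_assoc_Arr\<close>)
    moreover have "seq_map \<A> (Ident \<A> B) (Ident \<A> A) ds ds" using seq_map_refl[OF single(4)] .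
    ultimately show ?thesis
      using single(3,4) s(2,5) v c(3,5) fA by (intro exI[of _ A] exI[of _ ds] exI[of _ "Ident \<A> A"] exI[of _ v]) auto
  next
    case (splice i p j t' ds')
    then show ?thesis using SeqD(1)[OF splice(5)] by simp
  qed
next
  case (splice i' p' B' N' t A' j' ds')
  from splice(6) show ?case
  proof (cases rule: Seq_cases)
    case (single i p)
    then show ?thesis using SeqD(1)[OF splice(4)] by simp
  next
    case s: (splice i p j t' ds1)
    have [simp]: "t' = t" using s(1) by simp
    note ip = conflationD[OF s(3)] and ip' = conflationD[OF splice(1)]
    have j': "j' \<in> Arr \<A>" "Dom \<A> j' = N'" using SeqD[OF splice(4)] by auto
    have fA: "f \<in> Arr \<A>" using seq_map_Arr[OF splice(7)] by simp
    obtain c k where ck: "comm_square \<A> (ZeroMor \<A> B' B) c i' i" "comm_square \<A> c k p' p"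
      "seq_map \<A> k f (j' # ds') (j # ds1)"
      using seq_map_unsplice[OF splice(7)[unfolded s(2)] splice(1) s(3)] j' s(6,7) splice(3) by metis
    then have c: "c \<in> Arr \<A>" "Dom \<A> c = Dom \<A> p'" "Cod \<A> c = Dom \<A> p" "c \<cdot> i' = i \<cdot> ZeroMor \<A> B' B"
      "k \<in> Arr \<A>" "Dom \<A> k = N'" "Cod \<A> k = Cod \<A> p" "k \<cdot> p' = p \<cdot> c"
      using ip ip' splice(3) by (simp_all add: comm_square_def)
    have "c \<cdot> i' = ZeroMor \<A> (Dom \<A> i') (Cod \<A> c)" using c ip ip' s splice(2) by auto
    then obtain v where v: "v \<in> Arr \<A>" "Dom \<A> v = N'" "Cod \<A> v = Dom \<A> p" "v \<cdot> p' = c"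
      using is_cokernelE[OF ip'(10), of c] c ip'(3) splice(3) by metis
    have k: "k = p \<cdot> v"
      by (rule is_epiD[OF ip'(9)]) (use c v ip(1-3) ip'(1-3) splice(3) in \<open>simp_all add: Comp_assoc_Arr\<close>)
    obtain q' where q': "conflation \<A> \<C> j' q'" using Seq_first[OF splice(4)] by (metis list.inject)
    \<comment> \<open>The push-out of \<open>j'\<close> along \<open>v\<close> enlarges the middle
      term \<open>Dom \<A> p\<close> by \<open>jE\<close>, and in the enlarged object
      \<open>jE \<cdot> v\<close> extends over \<open>j'\<close> as \<open>w\<close>. Pushing
      \<open>jE\<close> out along \<open>p\<close> enlarges the cokernel by \<open>jK\<close>; then
      \<open>jE \<cdot> i\<close> and \<open>pF\<close> form the enlarged conflation, still starting
      at \<open>B\<close>.\<close>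
    obtain w jE qE where po: "is_pushout \<A> j' v w jE" and E: "conflation \<A> \<C> jE qE"
      using ex_pushout_conflation[OF q', of v] v j' ip(5) by metis
    note jE = conflationD[OF E]
    have w: "w \<in> Arr \<A>" "Dom \<A> w = Cod \<A> j'" "Cod \<A> w = Cod \<A> jE" "Dom \<A> jE = Dom \<A> p" "w \<cdot> j' = jE \<cdot> v"
      using po v(3) by (simp_all add: is_pushout_def)
    obtain pF jK qK where po2: "is_pushout \<A> jE p pF jK" and K: "conflation \<A> \<C> jK qK"
      using ex_pushout_conflation[OF E, of p] ip w by metis
    note jK = conflationD[OF K]
    have pF: "pF \<in> Arr \<A>" "Dom \<A> pF = Cod \<A> jE" "Cod \<A> pF = Cod \<A> jK" "Dom \<A> jK = Cod \<A> p" "pF \<cdot> jE = jK \<cdot> p"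
      using po2 by (simp_all add: is_pushout_def)
    have F: "conflation \<A> \<C> (jE \<cdot> i) pF"
      using conflation_Comp[OF s(3) E po2] w pF ip jK by simp
    obtain ds2 where push: "push_seq \<A> jK (j # ds1) ds2"
      using ex_push_seq[OF s(5), of jK] jK pF by auto
    have ds2: "Seq t A (Cod \<A> jK) ds2" "seq_map \<A> jK (Ident \<A> A) (j # ds1) ds2"
      using push_seq_Seq[OF s(5) push] jK by auto
    have "seq_map \<A> (jK \<cdot> k) (Ident \<A> A \<cdot> f) (j' # ds') ds2"
      using seq_map_Comp[OF ck(3) ds2(2)] c pF by simp
    moreover have "Cod \<A> f = A" using seq_map_Dom_Cod_last[OF ck(3)] SeqD(6)[OF s(5)] by simp
    ultimately have 1: "seq_map \<A> (jK \<cdot> k) f (j' # ds') ds2" using fA by simp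
    \<comment> \<open>After the enlargement the component \<open>k\<close>, which need not vanish,
      factors through the first morphism \<open>j'\<close> of the source. It can therefore be
      removed by a homotopy, which restores the zero left end required by the induction
      hypothesis.\<close>
    have "jK \<cdot> k = (pF \<cdot> jE) \<cdot> v" using k pF v ip(2) jK(1) by (simp add: Comp_assoc_Arr)
    also have "\<dots> = (pF \<cdot> w) \<cdot> j'" using pF(1,2) jE(1) v(1-3) w j' by (simp add: Comp_assoc_Arr)
    finally have 2: "jK \<cdot> k = (pF \<cdot> w) \<cdot> j'" .
    obtain x y ds3 where x: "ds2 = x # y # ds3" "Dom \<A> x = Cod \<A> jK" "y \<cdot> x = ZeroMor \<A> (Cod \<A> jK) (Cod \<A> y)"
      using Seq_first[OF ds2(1)] by metis
    obtain y' ds4 where y': "ds' = y' # ds4" using SeqD(1,2)[OF splice(4)] by (cases ds') auto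
    have "seq_map \<A> (ZeroMor \<A> N' (Cod \<A> jK)) f (j' # ds') ds2"
      using seq_map_left_homotopy[of "jK \<cdot> k" f j' y' ds4 x y ds3 "pF \<cdot> w"] 1 2 x y' pF w j' by simp
    from splice(5)[OF ds2(1) this] obtain M es m v' where es: "Seq t M (Cod \<A> jK) es"
      "seq_map \<A> (Ident \<A> (Cod \<A> jK)) m ds2 es" "v' \<in> Arr \<A>" "Dom \<A> v' = A'" "Cod \<A> v' = Dom \<A> (last es)"
      "m \<cdot> f = last es \<cdot> v'" by blast
    obtain j1 es1 where es1: "es = j1 # es1" "es1 \<noteq> []" using Seq_first[OF es(1)] by (metis list.distinct(1))
    have j1: "Dom \<A> j1 = Cod \<A> jK" using SeqD(5)[OF es(1)] es1 by simp
    have mA: "m \<in> Arr \<A>" using seq_map_Arr[OF es(2)] by simp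
    have "Dom \<A> m = A" using seq_map_Dom_Cod_last[OF es(2)] SeqD(6)[OF ds2(1)] x by simp
    then have "seq_map \<A> jK m (j # ds1) es"
      using seq_map_Comp[OF ds2(2) es(2)] jK(1,5) mA jK(3) jK(4) conflationD(5)[OF K] by simp
    \<comment> \<open>The chain map out of \<open>ds\<close> is the identity on \<open>B\<close>,
      \<open>jE\<close> on the first middle term and \<open>jK\<close> on its cokernel; further
      right it is the push-out map followed by the one from the induction hypothesis.\<close>
    moreover have "comm_square \<A> (Ident \<A> B) jE i (jE \<cdot> i)" "comm_square \<A> jE jK p pF"
      using s(4) ip w pF jE jK by (auto simp: comm_square_def)
    ultimately have "seq_map \<A> (Ident \<A> B) m ds ((jE \<cdot> i) # (j1 \<cdot> pF) # es1)"
      unfolding s(2) es1 using seq_map_splice by blast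
    moreover have "Seq (Suc t) M B ((jE \<cdot> i) # (j1 \<cdot> pF) # es1)"
      using spliced.splice[OF F _ pF(3) es(1)[unfolded es1(1)]] s(4) ip w jE by simp
    moreover have "last ((jE \<cdot> i) # (j1 \<cdot> pF) # es1) = last es" using es1 by simp
    ultimately show ?thesis using es(3-6) by metis
  qed
qed

end

section \<open>Duality\<close>

text \<open>The opposite category is of the same record type, and forming it twice returns
  \<open>\<A>\<close>. Hence every lemma can be applied in it, and a transfer proved in one
  direction gives the other direction as well.\<close>

definition op_cat :: "('o, 'm) ab_cat \<Rightarrow> ('o, 'm) ab_cat" where
  "op_cat \<A> = \<lparr>Obj = Obj \<A>, Arr = Arr \<A>, Dom = Cod \<A>, Cod = Dom \<A>, Ident = Ident \<A>,
     Comp = (\<lambda>g f. Comp \<A> f g), Plus = Plus \<A>, ZeroMor = (\<lambda>A B. ZeroMor \<A> B A)\<rparr>"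

lemma op_cat_simps [simp]:
  "Obj (op_cat \<A>) = Obj \<A>" "Arr (op_cat \<A>) = Arr \<A>" "Dom (op_cat \<A>) = Cod \<A>"
  "Cod (op_cat \<A>) = Dom \<A>" "Ident (op_cat \<A>) = Ident \<A>" "Comp (op_cat \<A>) g f = Comp \<A> f g"
  "Plus (op_cat \<A>) = Plus \<A>" "ZeroMor (op_cat \<A>) A B = ZeroMor \<A> B A" "op_cat (op_cat \<A>) = \<A>"
  by (simp_all add: op_cat_def)

lemma Hom_op [simp]: "Hom (op_cat \<A>) A B = Hom \<A> B A"
  by (auto simp: Hom_def)

lemma Hom_group_op [simp]: "Hom_group (op_cat \<A>) A B = Hom_group \<A> B A"
  by (simp add: Hom_group_def)

lemma is_mono_op [simp]: "is_mono (op_cat \<A>) f \<longleftrightarrow> is_epi \<A> f"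
  by (simp add: is_mono_def is_epi_def)

lemma is_epi_op [simp]: "is_epi (op_cat \<A>) f \<longleftrightarrow> is_mono \<A> f"
  by (simp add: is_mono_def is_epi_def)

lemma is_kernel_op [simp]: "is_kernel (op_cat \<A>) k f \<longleftrightarrow> is_cokernel \<A> k f"
  by (auto simp: is_kernel_def is_cokernel_def)

lemma is_cokernel_op [simp]: "is_cokernel (op_cat \<A>) c f \<longleftrightarrow> is_kernel \<A> c f"
  by (auto simp: is_kernel_def is_cokernel_def)

lemma short_exact_op [simp]: "short_exact (op_cat \<A>) p i \<longleftrightarrow> short_exact \<A> i p"
  by (auto simp: short_exact_def)

lemma is_zero_obj_op [simp]: "is_zero_obj (op_cat \<A>) N \<longleftrightarrow> is_zero_obj \<A> N"
  by (auto simp: is_zero_obj_def)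

lemma is_biproduct_op [simp]:
  "is_biproduct (op_cat \<A>) A B S p q i j \<longleftrightarrow> is_biproduct \<A> A B S i j p q"
  by (auto simp: is_biproduct_def)

lemma is_pushout_op [simp]: "is_pushout (op_cat \<A>) f g f' g' \<longleftrightarrow> is_pullback \<A> f g f' g'"
  by (simp add: is_pushout_def is_pullback_def)

lemma comm_square_op [simp]: "comm_square (op_cat \<A>) c b e d \<longleftrightarrow> comm_square \<A> b c d e"
  by (auto simp: comm_square_def)

text \<open>Dualising reverses the lists, exchanges source and target of the chain map, and swaps
  its two ends.\<close>

lemma seq_map_op_imp: "seq_map \<A> b a ds es \<Longrightarrow> seq_map (op_cat \<A>) a b (rev es) (rev ds)"
proof (induction b a ds es rule: seq_map.induct)
  case (2 b a d ds e es)
  then obtain c where "comm_square \<A> b c d e" "seq_map \<A> c a ds es" by auto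
  moreover have "length (rev es) = length (rev ds)" using seq_map_length[OF calculation(2)] by simp
  ultimately show ?case using 2(1) by (auto simp: seq_map_append_singleton)
qed auto

lemma seq_map_op [simp]: "seq_map (op_cat \<A>) a b (rev es) (rev ds) \<longleftrightarrow> seq_map \<A> b a ds es"
  using seq_map_op_imp[of \<A> b a ds es] seq_map_op_imp[of "op_cat \<A>" a b "rev es" "rev ds"] by auto

lemma push_seq_op_imp: "push_seq (op_cat \<A>) h ds es \<Longrightarrow> pull_seq \<A> h (rev ds) (rev es)"
  by (induction rule: push_seq.induct) (auto intro!: pull_hom pull_ext)

lemma pull_seq_imp_push_seq_op: "pull_seq \<A> h ds es \<Longrightarrow> push_seq (op_cat \<A>) h (rev ds) (rev es)"
  by (induction rule: pull_seq.induct)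
    (auto intro!: push_ext intro: push_hom[where \<A> = "op_cat \<A>", simplified])

context extension_closed_subcategory
begin

lemma category_op: "category (op_cat \<A>)"
  by (rule category.intro) (auto simp: Ident_Hom Comp_Ident Ident_Comp intro: Comp_Hom Comp_assoc[symmetric])

lemma preadditive_category_op: "preadditive_category (op_cat \<A>)"
  by (intro preadditive_category.intro preadditive_category_axioms.intro category_op)
    (simp_all add: Hom_comm_group Comp_Plus Plus_Comp)

lemma abelian_category_op: "abelian_category (op_cat \<A>)"
proof (intro abelian_category.intro additive_category.intro preadditive_category_op
    additive_category_axioms.intro abelian_category_axioms.intro)
  show "\<exists>S i j p q. is_biproduct (op_cat \<A>) A B S i j p q"
    if "A \<in> Obj (op_cat \<A>)" "B \<in> Obj (op_cat \<A>)" for A B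
    using ex_biproduct[of A B] that by (metis is_biproduct_op op_cat_simps(1))
qed (simp_all add: ex_zero_obj ex_kernel ex_cokernel mono_normal epi_normal)

lemma extension_closed_subcategory_op: "extension_closed_subcategory (op_cat \<A>) \<C>"
proof (intro extension_closed_subcategory.intro abelian_category_op extension_closed_subcategory_axioms.intro)
  show "\<exists>S \<in> \<C>. \<exists>i j p q. is_biproduct (op_cat \<A>) A B S i j p q" if "A \<in> \<C>" "B \<in> \<C>" for A B
    using sub_biproduct[of A B] that by simp blast
  show "Cod (op_cat \<A>) i \<in> \<C>"
    if "short_exact (op_cat \<A>) i p" "Dom (op_cat \<A>) i \<in> \<C>" "Cod (op_cat \<A>) p \<in> \<C>" for i p
  proof -
    have "short_exact \<A> p i" using that(1) by simp
    moreover from this have "Cod \<A> p = Dom \<A> i" by (simp add: short_exact_def is_kernel_def)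
    ultimately show ?thesis using extension_closed[of p i] that(2,3) by simp
  qed
qed (use sub_Obj sub_zero_obj in simp_all)

lemma conflation_op: "conflation (op_cat \<A>) \<C> p i \<longleftrightarrow> conflation \<A> \<C> i p"
proof -
  have "Cod \<A> i = Dom \<A> p" if "short_exact \<A> i p"
    using that by (simp add: short_exact_def is_kernel_def)
  then show ?thesis by (auto simp: conflation_def)
qed

text \<open>The inductive definition splices conflations on at the left; reversing a list turns this
  into splicing at the right, which is what duality of sequences rests on.\<close>

lemma Seq_snoc:
  assumes "Seq t L B (ds @ [p])" "conflation \<A> \<C> i q" "Dom \<A> i = L" "Cod \<A> q = A"
  shows "Seq (Suc t) A B (ds @ [i \<cdot> p, q])"
  using assms(1,3)
proof (induction t L B "ds @ [p]" arbitrary: ds rule: spliced.induct)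
  case (single i' p' B L)
  then have ds: "ds = [i']" "p' = p" by auto
  show ?case
    using spliced.splice[where R = "conflation \<A> \<C>", OF single(1,2), of L 1 A i "[q]"]
      spliced.single[where R = "conflation \<A> \<C>", OF assms(2), of \<A> L A]
      single(3,5) assms(4)
    by (simp add: ds)
next
  case (splice i' p' B K t L j ds')
  have "ds' \<noteq> []" using SeqD(1,2)[OF splice(4)] by auto
  then obtain ds2 y where "ds' = ds2 @ [y]" by (cases ds' rule: rev_cases) auto
  then have ds: "ds = i' # (j \<cdot> p') # ds2" "ds' = ds2 @ [p]"
    using splice(6) by (metis append1_eq_conv append_Cons)+
  then have "Seq (Suc t) A K ((j # ds2) @ [i \<cdot> p, q])"
    using splice(5)[of "j # ds2"] splice(7) by simp
  then show ?case
    using spliced.splice[where R = "conflation \<A> \<C>", OF splice(1-3),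
        of "Suc t" A j "ds2 @ [i \<cdot> p, q]"] ds by simp
qed

interpretation op: extension_closed_subcategory "op_cat \<A>" \<C>
  by (rule extension_closed_subcategory_op)

lemma Seq_op_imp: "Seq t A B ds \<Longrightarrow> op.Seq t B A (rev ds)"
proof (induction rule: spliced.induct)
  case (single i p B A)
  then show ?case
    using spliced.single[of "conflation (op_cat \<A>) \<C>" p i "op_cat \<A>"] conflation_op[of p i] by simp
next
  case (splice i p B K t A j ds)
  then show ?case using op.Seq_snoc[of t K A "rev ds" j p i B] conflation_op[of p i] by simp
qed

end

lemma (in extension_closed_subcategory) Seq_op [simp]:
  "spliced (op_cat \<A>) (conflation (op_cat \<A>) \<C>) t B A (rev ds) \<longleftrightarrow> Seq t A B ds"
  using Seq_op_imp[of t A B ds]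
    extension_closed_subcategory.Seq_op_imp[OF extension_closed_subcategory_op, of t B A "rev ds"] by auto

section \<open>Pull-backs by duality, and null sequences\<close>

context extension_closed_subcategory
begin

interpretation op: extension_closed_subcategory "op_cat \<A>" \<C>
  by (rule extension_closed_subcategory_op)

lemma ex_pull_seq:
  assumes "Seq t A B ds" "h \<in> Arr \<A>" "Cod \<A> h = A" "Dom \<A> h \<in> \<C>"
  obtains es where "pull_seq \<A> h ds es"
proof -
  obtain es where "push_seq (op_cat \<A>) h (rev ds) es"
    using op.ex_push_seq[of t B A "rev ds" h] assms by auto
  then show thesis using push_seq_op_imp that by fastforce
qed

lemma pull_seq_Seq:
  assumes "Seq t A B ds" "pull_seq \<A> h ds es" "Dom \<A> h \<in> \<C>"
  shows "Seq t (Dom \<A> h) B es" "seq_map \<A> (Ident \<A> B) h es ds"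
  using op.push_seq_Seq[of t B A "rev ds" h "rev es"] assms
    pull_seq_imp_push_seq_op[OF assms(2)] by simp_all

lemma seq_map_pull_seq:
  assumes "Seq t A B es" "Seq t A' B' ds" "pull_seq \<A> h es es'" "seq_map \<A> b (h \<cdot> k) ds es"
    "k \<in> Arr \<A>" "Cod \<A> k = Dom \<A> h" "Dom \<A> k = A'"
  shows "seq_map \<A> b k ds es'"
  using op.seq_map_push_seq[of t B A "rev es" B' A' "rev ds" h "rev es'" k b] assms
    pull_seq_imp_push_seq_op[OF assms(3)] by simp

text \<open>The far end \<open>M\<close> is left free. By \<open>seq_map_push_seq\<close> the
  condition says that a push-out of some sequence along a zero morphism maps to \<open>ds\<close>
  with identities at both ends.\<close>

definition null_left :: "nat \<Rightarrow> 'a \<Rightarrow> 'a \<Rightarrow> 'b list \<Rightarrow> bool" where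
  "null_left t A B ds \<longleftrightarrow> (\<exists>M es. Seq t A M es \<and> seq_map \<A> (ZeroMor \<A> M B) (Ident \<A> A) es ds)"

definition null_right :: "nat \<Rightarrow> 'a \<Rightarrow> 'a \<Rightarrow> 'b list \<Rightarrow> bool" where
  "null_right t A B ds \<longleftrightarrow> (\<exists>M es. Seq t M B es \<and> seq_map \<A> (Ident \<A> B) (ZeroMor \<A> A M) ds es)"

end

context extension_closed_subcategory
begin

interpretation op: extension_closed_subcategory "op_cat \<A>" \<C>
  by (rule extension_closed_subcategory_op)

lemma null_left_op [simp]: "op.null_left t B A (rev ds) \<longleftrightarrow> null_right t A B ds"
  unfolding null_right_def op.null_left_def by (metis Seq_op op_cat_simps(5,8) rev_rev_ident seq_map_op)

lemma null_right_op [simp]: "op.null_right t B A (rev ds) \<longleftrightarrow> null_left t A B ds"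
  unfolding null_left_def op.null_right_def by (metis Seq_op op_cat_simps(5,8) rev_rev_ident seq_map_op)

text \<open>For \<open>f\<close> the identity, \<open>pullback_obstruction\<close> yields a chain
  map from \<open>ds\<close> to some \<open>es\<close> whose right component \<open>m\<close> itself
  factors through the last morphism of \<open>es\<close>. The dual of
  \<open>seq_map_left_homotopy\<close> then replaces \<open>m\<close> by zero without touching the
  left end.\<close>

lemma null_left_imp_null_right:
  assumes ds: "Seq t A B ds" and null: "null_left t A B ds"
  shows "null_right t A B ds"
proof -
  obtain M es m v where es: "Seq t M B es" "seq_map \<A> (Ident \<A> B) m ds es"
    "v \<in> Arr \<A>" "Dom \<A> v = A" "Cod \<A> v = Dom \<A> (last es)" "m \<cdot> Ident \<A> A = last es \<cdot> v"
    using null pullback_obstruction[OF _ ds] unfolding null_left_def by blast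
  have "ds \<noteq> []" using SeqD(2)[OF ds] by auto
  then have "Dom \<A> m = A" using seq_map_Dom_Cod_last[OF es(2)] SeqD(6)[OF ds] by simp
  then have m: "m = last es \<cdot> v" using es(2,6) seq_map_Arr[OF es(2)] by simp
  obtain d e ds' p where d0: "rev ds = d # e # ds'" "conflation (op_cat \<A>) \<C> d p"
    "Dom (op_cat \<A>) d = A" "e \<in> Arr (op_cat \<A>)" "Dom (op_cat \<A>) e = Cod (op_cat \<A>) d"
    "e \<cdot>\<^bsub>op_cat \<A>\<^esub> d = ZeroMor (op_cat \<A>) A (Cod (op_cat \<A>) e)"
    by (rule op.Seq_first[OF Seq_op[THEN iffD2, OF ds]])
  then have d: "rev ds = d # e # ds'" "Cod \<A> d = A" "d \<cdot> e = ZeroMor \<A> (Dom \<A> e) A"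
    by (simp_all only: op_cat_simps)
  obtain x y es' q where "rev es = x # y # es'" "conflation (op_cat \<A>) \<C> x q"
    "Dom (op_cat \<A>) x = M" "y \<in> Arr (op_cat \<A>)" "Dom (op_cat \<A>) y = Cod (op_cat \<A>) x"
    "y \<cdot>\<^bsub>op_cat \<A>\<^esub> x = ZeroMor (op_cat \<A>) M (Cod (op_cat \<A>) y)"
    by (rule op.Seq_first[OF Seq_op[THEN iffD2, OF es(1)]])
  then have x: "rev es = x # y # es'" "Cod \<A> x = M"
    by (simp_all only: op_cat_simps)
  have "x = last es" using x(1) by (metis last_rev list.sel(1) rev_is_Nil_conv list.distinct(1) hd_rev)
  have "seq_map (op_cat \<A>) m (Ident \<A> B) (rev es) (rev ds)" using es(2) by (simp only: seq_map_op)
  then have 1: "seq_map (op_cat \<A>) m (Ident \<A> B) (x # y # es') (d # e # ds')"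
    by (simp only: x(1) d(1))
  \<comment> \<open>Read in the opposite category, \<open>m = last es \<cdot> v\<close> says that
    \<open>m\<close> is \<open>v\<close> composed after the first morphism \<open>x\<close> of the
    reversed list, so \<open>v\<close> is the homotopy.\<close>
  have "seq_map (op_cat \<A>) (ZeroMor \<A> A M) (Ident \<A> B) (x # y # es') (d # e # ds')"
    using op.seq_map_left_homotopy[OF 1, of v] es(3-5) m d(2,3) x(2) \<open>x = last es\<close>
    by (simp del: seq_map.simps)
  then have "seq_map (op_cat \<A>) (ZeroMor \<A> A M) (Ident \<A> B) (rev es) (rev ds)"
    by (simp only: x(1) d(1))
  then show ?thesis using es(1) unfolding null_right_def seq_map_op by blast
qed

end

context extension_closed_subcategory
begin

interpretation op: extension_closed_subcategory "op_cat \<A>" \<C>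
  by (rule extension_closed_subcategory_op)

lemma null_left_iff_null_right: "Seq t A B ds \<Longrightarrow> null_left t A B ds \<longleftrightarrow> null_right t A B ds"
  using null_left_imp_null_right op.null_left_imp_null_right[of t B A "rev ds"] by auto

text \<open>
  Chain maps carry \<open>null_left\<close> forwards and \<open>null_right\<close> backwards; since the two are equivalent,
  both are invariant under zigzags.
\<close>

lemma null_left_seq_map:
  assumes ds: "Seq t A B ds" and es: "Seq t A B es" and m: "seq_map \<A> (Ident \<A> B) (Ident \<A> A) ds es"
  shows "null_left t A B ds \<longleftrightarrow> null_left t A B es"
proof
  assume "null_left t A B ds"
  then obtain M rs where rs: "Seq t A M rs" "seq_map \<A> (ZeroMor \<A> M B) (Ident \<A> A) rs ds"
    unfolding null_left_def by blast
  have "Ident \<A> B \<cdot> ZeroMor \<A> M B = ZeroMor \<A> M B" "Ident \<A> A \<cdot> Ident \<A> A = Ident \<A> A"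
    using SeqD(3,4)[OF rs(1)] SeqD(3,4)[OF ds] by simp_all
  then show "null_left t A B es"
    using seq_map_Comp[OF rs(2) m] rs(1) SeqD(4)[OF rs(1)] SeqD(4)[OF ds] unfolding null_left_def by auto
next
  assume "null_left t A B es"
  then obtain M rs where rs: "Seq t M B rs" "seq_map \<A> (Ident \<A> B) (ZeroMor \<A> A M) es rs"
    unfolding null_left_iff_null_right[OF es] null_right_def by blast
  have "ZeroMor \<A> A M \<cdot> Ident \<A> A = ZeroMor \<A> A M" "Ident \<A> B \<cdot> Ident \<A> B = Ident \<A> B"
    using SeqD(3,4)[OF rs(1)] SeqD(3,4)[OF ds] by simp_all
  then show "null_left t A B ds"
    using seq_map_Comp[OF m rs(2)] rs(1) SeqD(4)[OF ds]
    unfolding null_left_iff_null_right[OF ds] null_right_def by auto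
qed

text \<open>The part of the long exact sequence of Ext that the theorem needs.\<close>

lemma lift_along_deflation:
  assumes es: "Seq t P X es" and ip: "conflation \<A> \<C> i p" "Cod \<A> p = X"
    and null: "null_left (Suc t) P (Dom \<A> i) (i # (hd es \<cdot> p) # tl es)"
    and cs: "Seq t Z X cs" and f: "f \<in> Arr \<A>" "Dom \<A> f = Z" "Cod \<A> f = P"
    and m: "seq_map \<A> (Ident \<A> X) f cs es"
  obtains cs' rs where "Seq t Z X cs'" "seq_map \<A> (Ident \<A> X) (Ident \<A> Z) cs cs'"
    "Seq t Z (Dom \<A> p) rs" "seq_map \<A> p (Ident \<A> Z) rs cs'"
proof -
  note i = conflationD[OF ip(1)]
  obtain e0 es1 where es1: "es = e0 # es1" using Seq_first[OF es] by metis
  have e0: "e0 \<in> Arr \<A>" "Dom \<A> e0 = Cod \<A> p" using SeqD[OF es] es1 ip(2) by auto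
  have Z: "Z \<in> \<C>" "X \<in> \<C>" "P \<in> \<C>" using SeqD[OF cs] SeqD[OF es] by auto
  obtain M ms where ms: "Seq (Suc t) P M ms"
    "seq_map \<A> (ZeroMor \<A> M (Dom \<A> i)) (Ident \<A> P) ms (i # (e0 \<cdot> p) # es1)"
    using null es1 unfolding null_left_def by auto
  \<comment> \<open>The witness is cut after its first conflation: \<open>ns\<close> is the
    remainder, starting at the cokernel \<open>N\<close>, and its chain map to \<open>es\<close> has
    left end \<open>p \<cdot> g\<close>.\<close>
  from ms(1) obtain N g ns where ns: "Seq t P N ns" "seq_map \<A> (p \<cdot> g) (Ident \<A> P) ns es"
    "g \<in> Arr \<A>" "Dom \<A> g = N" "Cod \<A> g = Dom \<A> p"
  proof (cases rule: Seq_cases)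
    case (single i p)
    then show thesis using SeqD(1)[OF es] by simp
  next
    case (splice i' q j t' ds)
    note i' = conflationD[OF splice(3)]
    obtain c k where c: "comm_square \<A> (ZeroMor \<A> M (Dom \<A> i)) c i' i" "comm_square \<A> c k q p"
      "seq_map \<A> k (Ident \<A> P) (j # ds) (e0 # es1)"
      using seq_map_unsplice[OF ms(2)[unfolded splice(2)] splice(3) ip(1)] splice(6,7) e0 by metis
    then have t: "c \<in> Arr \<A>" "Dom \<A> c = Dom \<A> q" "Cod \<A> c = Dom \<A> p" "c \<cdot> i' = i \<cdot> ZeroMor \<A> M (Dom \<A> i)"
      "k \<in> Arr \<A>" "Dom \<A> k = Cod \<A> q" "Cod \<A> k = Cod \<A> p" "k \<cdot> q = p \<cdot> c"
      using i i' by (simp_all add: comm_square_def)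
    have "c \<cdot> i' = ZeroMor \<A> (Dom \<A> i') (Cod \<A> c)" using t i i' splice(4) by auto
    then obtain g where g: "g \<in> Arr \<A>" "Dom \<A> g = Cod \<A> q" "Cod \<A> g = Dom \<A> p" "g \<cdot> q = c"
      using is_cokernelE[OF i'(10), of c] t i'(3) by metis
    have "k = p \<cdot> g"
      by (rule is_epiD[OF i'(9)]) (use t g i(1-3) i'(1-3) in \<open>simp_all add: Comp_assoc_Arr\<close>)
    then show thesis using that[of "Cod \<A> q" "j # ds" g] splice(1,5) c(3) g es1 by simp
  qed
  \<comment> \<open>The sequence \<open>rs\<close> sought is \<open>ns\<close> pulled back along
    \<open>f\<close> and pushed out along \<open>g\<close>. The pull-back \<open>cs'\<close> of
    \<open>es\<close> along \<open>f\<close> serves as an intermediary: both \<open>cs\<close> and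
    \<open>rs\<close> map to it by universal properties.\<close>
  obtain rs0 where "pull_seq \<A> f ns rs0" using ex_pull_seq[OF ns(1), of f] f Z by auto
  then have rs0: "Seq t Z N rs0" "seq_map \<A> (Ident \<A> N) f rs0 ns"
    using pull_seq_Seq[OF ns(1)] f Z by auto
  obtain rs where push: "push_seq \<A> g rs0 rs" using ex_push_seq[OF rs0(1), of g] ns i by auto
  then have rs: "Seq t Z (Dom \<A> p) rs" using push_seq_Seq(1)[OF rs0(1) push] ns(5) i(5) by simp
  obtain cs' where pull: "pull_seq \<A> f es cs'" using ex_pull_seq[OF es, of f] f Z by auto
  then have cs': "Seq t Z X cs'" using pull_seq_Seq(1)[OF es pull] f Z by simp
  have N: "N \<in> \<C>" using SeqD[OF ns(1)] by simp
  have "seq_map \<A> ((p \<cdot> g) \<cdot> Ident \<A> N) (Ident \<A> P \<cdot> f) rs0 es"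
    using seq_map_Comp[OF rs0(2) ns(2)] ns i N by simp
  then have "seq_map \<A> (p \<cdot> g) f rs0 es" using f ns i N by simp
  then have "seq_map \<A> (p \<cdot> g) (Ident \<A> Z) rs0 cs'"
    using seq_map_pull_seq[OF es rs0(1) pull, of "p \<cdot> g" "Ident \<A> Z"] f Z by simp
  then have "seq_map \<A> p (Ident \<A> Z) rs cs'"
    using seq_map_push_seq[OF rs0(1) cs' push] ip ns i by simp
  moreover have "seq_map \<A> (Ident \<A> X) (Ident \<A> Z) cs cs'"
    using seq_map_pull_seq[OF es cs pull, of "Ident \<A> X" "Ident \<A> Z"] m f Z by simp
  ultimately show thesis using that rs cs' by blast
qed

end

context extension_closed_subcategory
begin

interpretation op: extension_closed_subcategory "op_cat \<A>" \<C>
  by (rule extension_closed_subcategory_op)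

text \<open>The dual of \<open>lift_along_deflation\<close>: under reversal the conflation is
  spliced on at the right instead of the left, and left null turns into right null.\<close>

lemma extend_along_inflation:
  assumes es: "Seq t Z Q es" and ip: "conflation \<A> \<C> i p" "Dom \<A> i = Z"
    and null: "null_right (Suc t) (Cod \<A> p) Q (butlast es @ [i \<cdot> last es, p])"
    and cs: "Seq t Z X cs" and f: "f \<in> Arr \<A>" "Dom \<A> f = Q" "Cod \<A> f = X"
    and m: "seq_map \<A> f (Ident \<A> Z) es cs"
  obtains cs' rs where "Seq t Z X cs'" "seq_map \<A> (Ident \<A> X) (Ident \<A> Z) cs' cs"
    "Seq t (Cod \<A> i) X rs" "seq_map \<A> (Ident \<A> X) i cs' rs"
proof -
  have "es \<noteq> []" using SeqD(2)[OF es] by auto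
  then have "p # (hd (rev es) \<cdot>\<^bsub>op_cat \<A>\<^esub> i) # tl (rev es) = rev (butlast es @ [i \<cdot> last es, p])"
    by (simp add: hd_rev) (metis butlast_rev rev_rev_ident rev_swap)
  then have n: "op.null_left (Suc t) Q (Dom (op_cat \<A>) p) (p # (hd (rev es) \<cdot>\<^bsub>op_cat \<A>\<^esub> i) # tl (rev es))"
    using null by (simp only: null_left_op op_cat_simps)
  have e: "op.Seq t Q Z (rev es)" "op.Seq t X Z (rev cs)" using es cs by auto
  have m': "seq_map (op_cat \<A>) (Ident (op_cat \<A>) Z) f (rev cs) (rev es)" using m by simp
  obtain cs' rs where "op.Seq t X Z cs'" "seq_map (op_cat \<A>) (Ident \<A> Z) (Ident \<A> X) (rev cs) cs'"
    "op.Seq t X (Cod \<A> i) rs" "seq_map (op_cat \<A>) i (Ident \<A> X) rs cs'"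
    using op.lift_along_deflation[OF e(1) _ _ n e(2) _ _ _ m'] ip f by (metis conflation_op op_cat_simps(2-5))
  then show thesis
    using that[of "rev cs'" "rev rs"] Seq_op[of t X Z "rev cs'"] Seq_op[of t X "Cod \<A> i" "rev rs"]
      seq_map_op[of \<A> "Ident \<A> Z" "Ident \<A> X" cs "rev cs'"] seq_map_op[of \<A> i "Ident \<A> X" "rev rs" "rev cs'"]
    by simp
qed

end

section \<open>Classes of extensions\<close>

text \<open>Adjacent squares share a component, which fixes the object between neighbouring
  morphisms. Applied to the identity chain map, this gives composability of a spliced
  sequence.\<close>

lemma seq_map_nth_Cod:
  "seq_map \<A> b a ds es \<Longrightarrow> Suc k < length ds \<Longrightarrow> Cod \<A> (ds ! k) = Dom \<A> (ds ! Suc k)"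
proof (induction b a ds es arbitrary: k rule: seq_map.induct)
  case (2 b a d ds e es)
  then obtain c where c: "comm_square \<A> b c d e" "seq_map \<A> c a ds es" by auto
  show ?case
  proof (cases k)
    case 0
    then have "ds \<noteq> []" using 2(3) by auto
    then show ?thesis using seq_map_Dom_Cod_hd[OF c(2)] c(1) 0 by (simp add: comm_square_def hd_conv_nth)
  next
    case (Suc l)
    then show ?thesis using 2(1)[OF c(2), of l] 2(3) by simp
  qed
qed auto

lemma seq_mapI:
  assumes "length ds = length es" "\<phi> (length ds) \<in> Arr \<A>"
    "\<And>k. k < length ds \<Longrightarrow> comm_square \<A> (\<phi> k) (\<phi> (Suc k)) (ds ! k) (es ! k)"
  shows "seq_map \<A> (\<phi> 0) (\<phi> (length ds)) ds es"
  using assms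
proof (induction ds es arbitrary: \<phi> rule: list_induct2)
  case (Cons d ds e es)
  have "seq_map \<A> (\<phi> (Suc 0)) (\<phi> (Suc (length ds))) ds es"
    using Cons.IH[of "\<lambda>k. \<phi> (Suc k)"] Cons.prems(1) Cons.prems(2)[of "Suc k" for k] by simp
  then show ?case using Cons.prems(2)[of 0] by auto
qed auto

lemma seq_mapD:
  assumes "seq_map \<A> b a ds es"
  shows "\<exists>\<phi>. \<phi> 0 = b \<and> \<phi> (length ds) = a \<and>
    (\<forall>k < length ds. comm_square \<A> (\<phi> k) (\<phi> (Suc k)) (ds ! k) (es ! k))"
  using assms
proof (induction b a ds es rule: seq_map.induct)
  case (2 b a d ds e es)
  then obtain c where c: "comm_square \<A> b c d e" "seq_map \<A> c a ds es" by auto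
  obtain \<phi> where "\<phi> 0 = c" "\<phi> (length ds) = a"
    "\<forall>k < length ds. comm_square \<A> (\<phi> k) (\<phi> (Suc k)) (ds ! k) (es ! k)"
    using 2(1)[OF c(2)] by blast
  \<comment> \<open>The family is shifted by one place and \<open>b\<close> is put in front as
    component 0.\<close>
  then show ?case
    using c(1) by (intro exI[of _ "case_nat b \<phi>"]) (auto simp: nth_Cons split: nat.splits)
qed auto

section \<open>Equivalence and vanishing of classes in terms of chain maps\<close>

context extension_closed_subcategory
begin

lemma ext_seqs_pos: "t \<ge> 1 \<Longrightarrow> ds \<in> ext_seqs \<A> \<C> t A B \<longleftrightarrow> Seq t A B ds"
  by (auto simp: ext_seqs_def)

lemma ext_step_iff:
  assumes "t \<ge> 1"
  shows "ext_step \<A> \<C> t A B ds es \<longleftrightarrow>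
    Seq t A B ds \<and> Seq t A B es \<and> seq_map \<A> (Ident \<A> B) (Ident \<A> A) ds es"
proof
  assume "ext_step \<A> \<C> t A B ds es"
  then obtain \<phi> where ds: "Seq t A B ds" and es: "Seq t A B es"
    and \<phi>: "\<phi> 0 = Ident \<A> B" "\<phi> (t + 1) = Ident \<A> A"
      "\<And>k. k \<le> t \<Longrightarrow> \<phi> k \<in> Hom \<A> (Dom \<A> (ds ! k)) (Dom \<A> (es ! k)) \<and> \<phi> (k + 1) \<cdot> (ds ! k) = (es ! k) \<cdot> \<phi> k"
    unfolding ext_step_def ext_seqs_pos[OF assms] by blast
  note D = SeqD[OF ds] and E = SeqD[OF es]
  have "ds \<noteq> []" "es \<noteq> []" using D(2) E(2) by auto
  then have last: "Cod \<A> (ds ! t) = A" "Cod \<A> (es ! t) = A"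
    using D(2,6) E(2,6) by (simp_all add: last_conv_nth)
  have sq: "comm_square \<A> (\<phi> k) (\<phi> (Suc k)) (ds ! k) (es ! k)" if "k < length ds" for k
  proof -
    have k: "k \<le> t" using that D(2) by simp
    have arr: "ds ! k \<in> Arr \<A>" "es ! k \<in> Arr \<A>" using D(2,7) E(2,7) that by (auto dest: nth_mem)
    have \<phi>k: "\<phi> k \<in> Arr \<A>" "Dom \<A> (\<phi> k) = Dom \<A> (ds ! k)" "Cod \<A> (\<phi> k) = Dom \<A> (es ! k)"
      "\<phi> (Suc k) \<cdot> ds ! k = es ! k \<cdot> \<phi> k"
      using \<phi>(3)[OF k] by (simp_all add: Hom_iff)
    have "\<phi> (Suc k) \<in> Arr \<A> \<and> Dom \<A> (\<phi> (Suc k)) = Cod \<A> (ds ! k) \<and> Cod \<A> (\<phi> (Suc k)) = Cod \<A> (es ! k)"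
    \<comment> \<open>The typing conditions in \<open>ext_step\<close> stop at index
      \<open>t\<close>. The type of the last component comes from its being the identity of
      \<open>A\<close>; for the other indices the domain of the next morphism is the codomain of the
      current one.\<close>
    proof (cases "k = t")
      case True
      then show ?thesis using \<phi>(2) last D(3) by simp
    next
      case False
      then have "Suc k \<le> t" "Suc k < length ds" "Suc k < length es" using k D(2) E(2) by auto
      then show ?thesis
        using \<phi>(3)[of "Suc k"] seq_map_nth_Cod[OF seq_map_refl[OF ds], of k]
          seq_map_nth_Cod[OF seq_map_refl[OF es], of k]
        by (simp add: Hom_iff)
    qed
    then show ?thesis using \<phi>k arr unfolding comm_square_def by blast
  qed
  have "seq_map \<A> (\<phi> 0) (\<phi> (length ds)) ds es"
    by (rule seq_mapI[OF _ _ sq]) (use D(2,3) E(2) \<phi>(2) in simp_all)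
  then show "Seq t A B ds \<and> Seq t A B es \<and> seq_map \<A> (Ident \<A> B) (Ident \<A> A) ds es"
    using ds es \<phi>(1,2) D(2) by simp
next
  assume "Seq t A B ds \<and> Seq t A B es \<and> seq_map \<A> (Ident \<A> B) (Ident \<A> A) ds es"
  then have ds: "Seq t A B ds" "Seq t A B es" and m: "seq_map \<A> (Ident \<A> B) (Ident \<A> A) ds es"
    by blast+
  obtain \<phi> where \<phi>: "\<phi> 0 = Ident \<A> B" "\<phi> (length ds) = Ident \<A> A"
    "\<And>k. k < length ds \<Longrightarrow> comm_square \<A> (\<phi> k) (\<phi> (Suc k)) (ds ! k) (es ! k)"
    using seq_mapD[OF m] by blast
  have "\<phi> k \<in> Hom \<A> (Dom \<A> (ds ! k)) (Dom \<A> (es ! k)) \<and> \<phi> (k + 1) \<cdot> (ds ! k) = (es ! k) \<cdot> \<phi> k"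
    if "k \<le> t" for k
    using \<phi>(3)[of k] that SeqD(2)[OF ds(1)] unfolding comm_square_def Hom_iff by force
  moreover have "\<phi> (t + 1) = Ident \<A> A" using \<phi>(2) SeqD(2)[OF ds(1)] by simp
  ultimately show "ext_step \<A> \<C> t A B ds es"
    unfolding ext_step_def ext_seqs_pos[OF assms] using ds \<phi>(1) by blast
qed

lemma ext_rel_iff:
  "t \<ge> 1 \<Longrightarrow> (ds, es) \<in> ext_rel \<A> \<C> t A B \<longleftrightarrow>
    Seq t A B ds \<and> Seq t A B es \<and> equivclp (ext_step \<A> \<C> t A B) ds es"
  by (auto simp: ext_rel_def ext_seqs_pos)

lemma equiv_ext_rel:
  assumes "t \<ge> 1"
  shows "equiv (ext_seqs \<A> \<C> t A B) (ext_rel \<A> \<C> t A B)"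
  by (intro equivI refl_onI symI transI)
    (auto simp: ext_rel_iff[OF assms] ext_seqs_pos[OF assms] intro: equivclp_sym equivclp_trans)

lemma null_left_equivclp:
  assumes "t \<ge> 1" "equivclp (ext_step \<A> \<C> t A B) ds es" "null_left t A B ds"
  shows "null_left t A B es"
  using assms(2,3)
  by (induction rule: equivclp_induct) (auto simp: ext_step_iff[OF assms(1)] null_left_seq_map)

text \<open>If \<open>j\<close> is a section of the first deflation \<open>p\<close>, the
  endomorphism \<open>j \<cdot> p\<close> of the middle term is zero on \<open>B\<close> and induces
  the identity on the cokernel. With identities further right it is a chain map from the sequence to
  itself, so the sequence witnesses its own nullness.\<close>

lemma split_spliced_null_left:
  assumes "spliced \<A> (split_conflation \<A> \<C>) t A B ds"
  shows "Seq t A B ds \<and> null_left t A B ds"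
proof -
  have Seq: "Seq t A B ds" if "spliced \<A> (split_conflation \<A> \<C>) t A B ds" for t A B ds
    using that
    by (induction rule: spliced.induct)
      (simp_all only: split_conflation_def spliced.single spliced.splice)
  have sq: "\<exists>c. comm_square \<A> (ZeroMor \<A> B B) c i i \<and> comm_square \<A> c (Ident \<A> K) p p"
    if sp: "split_conflation \<A> \<C> i p" "Dom \<A> i = B" "Cod \<A> p = K" for i p B K
  proof -
    obtain q j where c: "conflation \<A> \<C> i p" and b: "is_biproduct \<A> B K (Cod \<A> i) i j q p"
      using sp by (auto simp: split_conflation_def)
    note ip = conflationD[OF c]
    have b': "j \<in> Arr \<A>" "Dom \<A> j = K" "Cod \<A> j = Cod \<A> i" "p \<cdot> j = Ident \<A> K"
      using b by (auto simp: is_biproduct_def Hom_iff)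
    have "(j \<cdot> p) \<cdot> i = ZeroMor \<A> B (Cod \<A> i)" "p \<cdot> (j \<cdot> p) = p"
      using ip(1-7) b' sp by (simp_all add: Comp_assoc_Arr) (simp add: Comp_assoc_Arr[symmetric])
    then show ?thesis using ip(1-6) b' sp by (intro exI[of _ "j \<cdot> p"]) (auto simp: comm_square_def)
  qed
  show ?thesis
    using assms
  proof (cases rule: spliced.cases)
    case (single i p)
    obtain c where "comm_square \<A> (ZeroMor \<A> B B) c i i" "comm_square \<A> c (Ident \<A> A) p p"
      using sq[OF single(3-5)] by blast
    then have "seq_map \<A> (ZeroMor \<A> B B) (Ident \<A> A) ds ds"
      using single by (auto simp: comm_square_def)
    then show ?thesis using Seq[OF assms] unfolding null_left_def by blast
  next
    case (splice i p K t' j ds')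
    obtain c where "comm_square \<A> (ZeroMor \<A> B B) c i i" "comm_square \<A> c (Ident \<A> K) p p"
      using sq[OF splice(3-5)] by blast
    then have "seq_map \<A> (ZeroMor \<A> B B) (Ident \<A> A) ds ds"
      unfolding splice(2) using seq_map_splice seq_map_refl[OF Seq[OF splice(6)]] by blast
    then show ?thesis using Seq[OF assms] unfolding null_left_def by blast
  qed
qed

lemma Ext_vanishes_null_left:
  assumes t: "t \<ge> 1" and van: "Ext_vanishes \<A> \<C> t A B" and ds: "Seq t A B ds"
  shows "null_left t A B ds"
proof -
  have "ext_rel \<A> \<C> t A B `` {ds} \<in> Ext \<A> \<C> t A B"
    using ds unfolding Ext_def by (auto simp: ext_seqs_pos[OF t] intro: quotientI)
  then have "ext_rel \<A> \<C> t A B `` {ds} = ext_zero \<A> \<C> t A B"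
    using van by (simp add: Ext_vanishes_def Ext_group_def)
  \<comment> \<open>Since \<open>ds\<close> belongs to its own class, which is the image of the
    split sequences, some split sequence is related to \<open>ds\<close> by a zigzag.\<close>
  moreover have "ds \<in> ext_rel \<A> \<C> t A B `` {ds}"
    using ds by (auto simp: ext_rel_iff[OF t])
  ultimately obtain es where "spliced \<A> (split_conflation \<A> \<C>) t A B es" "(es, ds) \<in> ext_rel \<A> \<C> t A B"
    using t by (auto simp: ext_zero_def)
  then show ?thesis
    using split_spliced_null_left null_left_equivclp[OF t] by (auto simp: ext_rel_iff[OF t])
qed

end

text \<open>
  Common core of \<open>ext_push\<close> and \<open>ext_pull\<close> being well defined on classes: \<open>M\<close> says that there is a
  chain map over the given morphism, \<open>T\<close> that the second sequence is a push-out (pull-back).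
\<close>

lemma equivclp_transport:
  assumes step: "\<And>x y. S x y \<Longrightarrow> X x \<and> X y"
    and total: "\<And>x. X x \<Longrightarrow> \<exists>p. T x p"
    and T_M: "\<And>x p. X x \<Longrightarrow> T x p \<Longrightarrow> M x p"
    and univ: "\<And>x p z. X x \<Longrightarrow> T x p \<Longrightarrow> M x z \<Longrightarrow> equivclp S' p z"
    and M_step: "\<And>x y z. S x y \<Longrightarrow> M y z \<Longrightarrow> M x z"
    and start: "M d e" and "equivclp S d x" "X x" "T x p"
  shows "equivclp S' e p"
  using \<open>equivclp S d x\<close> \<open>X x\<close> \<open>T x p\<close>
proof (induction arbitrary: p rule: equivclp_induct)
  case base
  then show ?case using univ start equivclp_sym by metis
next
  case (step y z)
  then have X: "X y" "X z" using assms(1) by blast+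
  then obtain q where q: "T y q" using total by blast
  then have "equivclp S' e q" using step(3) X by blast
  \<comment> \<open>Whichever way the step points, the \<open>T\<close>-partner of its target
    satisfies \<open>M\<close> for its source by \<open>M_step\<close>, so \<open>univ\<close> at
    the source compares the two partners.\<close>
  moreover have "equivclp S' q p"
    using step(2)
  proof
    assume "S y z"
    then show ?thesis using univ[OF X(1) q] M_step T_M X step.prems by blast
  next
    assume "S z y"
    then have "equivclp S' p q" using univ[OF X(2) step.prems(2)] M_step T_M X q by blast
    then show ?thesis by (rule equivclp_sym)
  qed
  ultimately show ?case by (rule equivclp_trans)
qed

section \<open>Products on classes and the two implications\<close>

context extension_closed_subcategory
begin

text \<open>The rule by which products are computed: any chain map over \<open>g\<close> that is the
  identity on the right determines the product, even if its target is only equivalent to a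
  push-out.\<close>

lemma ext_push_class:
  assumes t: "t \<ge> 1" and ds: "Seq t A B ds" and es: "Seq t A B' es"
    and g: "g \<in> Arr \<A>" "Dom \<A> g = B" "Cod \<A> g = B'" and m: "seq_map \<A> g (Ident \<A> A) ds es"
  shows "ext_push \<A> \<C> t A g (ext_rel \<A> \<C> t A B `` {ds}) = ext_rel \<A> \<C> t A B' `` {es}"
proof -
  let ?S = "{ps. \<exists>xs \<in> ext_rel \<A> \<C> t A B `` {ds}. push_seq \<A> g xs ps}"
  have B: "B \<in> \<C>" "B' \<in> \<C>" "A \<in> \<C>" using SeqD[OF ds] SeqD[OF es] by auto
  have sub: "(es, ps) \<in> ext_rel \<A> \<C> t A B'" if "ps \<in> ?S" for ps
  proof -
    obtain xs where xs: "equivclp (ext_step \<A> \<C> t A B) ds xs" "Seq t A B xs" "push_seq \<A> g xs ps"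
      using \<open>ps \<in> ?S\<close> by (auto simp: ext_rel_iff[OF t])
    have "equivclp (ext_step \<A> \<C> t A B') es ps"
    proof (rule equivclp_transport[where X = "Seq t A B" and T = "push_seq \<A> g" and
          M = "\<lambda>x z. Seq t A B' z \<and> seq_map \<A> g (Ident \<A> A) x z", OF _ _ _ _ _ _ xs])
      show "\<exists>p. push_seq \<A> g x p" if "Seq t A B x" for x
        using ex_push_seq[OF that g(1,2)] g(3) B by metis
      show "Seq t A B' p \<and> seq_map \<A> g (Ident \<A> A) x p" if "Seq t A B x" "push_seq \<A> g x p" for x p
        using push_seq_Seq[OF that] g(3) B by simp
      show "equivclp (ext_step \<A> \<C> t A B') p z"
        if "Seq t A B x" "push_seq \<A> g x p" "Seq t A B' z \<and> seq_map \<A> g (Ident \<A> A) x z" for x p z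
        using seq_map_push_seq[OF that(1) _ that(2), of A B' z "Ident \<A> B'" "Ident \<A> A"] that(3)
          push_seq_Seq(1)[OF that(1,2)] g B
        by (intro r_into_equivclp) (simp add: ext_step_iff[OF t])
      show "Seq t A B' z \<and> seq_map \<A> g (Ident \<A> A) x z"
        if "ext_step \<A> \<C> t A B x y" "Seq t A B' z \<and> seq_map \<A> g (Ident \<A> A) y z" for x y z
        using that seq_map_Comp[of "Ident \<A> B" "Ident \<A> A" x y g "Ident \<A> A" z] g B
        by (simp add: ext_step_iff[OF t])
    qed (use es m in \<open>auto simp: ext_step_iff[OF t]\<close>)
    then show ?thesis using es push_seq_Seq(1)[OF xs(2,3)] g(3) B by (simp add: ext_rel_iff[OF t])
  qed
  obtain ps where "push_seq \<A> g ds ps" using ex_push_seq[OF ds g(1,2)] g(3) B by metis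
  then have "ps \<in> ?S" using ds by (auto simp: ext_rel_iff[OF t])
  then have "ext_rel \<A> \<C> t A B' `` ?S = ext_rel \<A> \<C> t A B' `` {es}"
    using sub equiv_class_eq[OF equiv_ext_rel[OF t]] by blast
  then show ?thesis unfolding ext_push_def g(3) .
qed

lemma ext_pull_class:
  assumes t: "t \<ge> 1" and ds: "Seq t A B ds" and es: "Seq t A' B es"
    and h: "h \<in> Arr \<A>" "Dom \<A> h = A'" "Cod \<A> h = A" and m: "seq_map \<A> (Ident \<A> B) h es ds"
  shows "ext_pull \<A> \<C> t B (ext_rel \<A> \<C> t A B `` {ds}) h = ext_rel \<A> \<C> t A' B `` {es}"
proof -
  let ?S = "{ps. \<exists>xs \<in> ext_rel \<A> \<C> t A B `` {ds}. pull_seq \<A> h xs ps}"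
  have A: "A \<in> \<C>" "A' \<in> \<C>" "B \<in> \<C>" using SeqD[OF ds] SeqD[OF es] by auto
  have sub: "(es, ps) \<in> ext_rel \<A> \<C> t A' B" if "ps \<in> ?S" for ps
  proof -
    obtain xs where xs: "equivclp (ext_step \<A> \<C> t A B) ds xs" "Seq t A B xs" "pull_seq \<A> h xs ps"
      using \<open>ps \<in> ?S\<close> by (auto simp: ext_rel_iff[OF t])
    \<comment> \<open>Chain maps lead from a pull-back to the original sequence, so composing with a
      step requires the opposite orientation; reversing all steps leaves the generated equivalence
      unchanged.\<close>
    have xs': "equivclp (ext_step \<A> \<C> t A B)\<inverse>\<inverse> ds xs" using xs(1) by simp
    have "equivclp (ext_step \<A> \<C> t A' B) es ps"
    proof (rule equivclp_transport[where X = "Seq t A B" and T = "pull_seq \<A> h" and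
          M = "\<lambda>x z. Seq t A' B z \<and> seq_map \<A> (Ident \<A> B) h z x", OF _ _ _ _ _ _ xs' xs(2,3)])
      show "\<exists>p. pull_seq \<A> h x p" if "Seq t A B x" for x
        using ex_pull_seq[OF that h(1,3)] h(2) A by metis
      show "Seq t A' B p \<and> seq_map \<A> (Ident \<A> B) h p x" if "Seq t A B x" "pull_seq \<A> h x p" for x p
        using pull_seq_Seq[OF that] h(2) A by simp
      show "equivclp (ext_step \<A> \<C> t A' B) p z"
        if "Seq t A B x" "pull_seq \<A> h x p" "Seq t A' B z \<and> seq_map \<A> (Ident \<A> B) h z x" for x p z
        using seq_map_pull_seq[OF that(1) _ that(2), of A' B z "Ident \<A> B" "Ident \<A> A'"] that(3)
          pull_seq_Seq(1)[OF that(1,2)] h A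
        by (intro equivclp_sym[OF r_into_equivclp]) (simp add: ext_step_iff[OF t])
      show "Seq t A' B z \<and> seq_map \<A> (Ident \<A> B) h z x"
        if "(ext_step \<A> \<C> t A B)\<inverse>\<inverse> x y" "Seq t A' B z \<and> seq_map \<A> (Ident \<A> B) h z y" for x y z
        using that seq_map_Comp[of "Ident \<A> B" h z y "Ident \<A> B" "Ident \<A> A" x] h A
        by (simp add: ext_step_iff[OF t])
    qed (use es m in \<open>auto simp: ext_step_iff[OF t]\<close>)
    then show ?thesis using es pull_seq_Seq(1)[OF xs(2,3)] h(2) A by (simp add: ext_rel_iff[OF t])
  qed
  obtain ps where "pull_seq \<A> h ds ps" using ex_pull_seq[OF ds h(1,3)] h(2) A by metis
  then have "ps \<in> ?S" using ds by (auto simp: ext_rel_iff[OF t])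
  then have "ext_rel \<A> \<C> t A' B `` ?S = ext_rel \<A> \<C> t A' B `` {es}"
    using sub equiv_class_eq[OF equiv_ext_rel[OF t]] by blast
  then show ?thesis unfolding ext_pull_def h(2) .
qed

lemma Ext_E:
  assumes "t \<ge> 1" "\<gamma> \<in> Ext \<A> \<C> t A B"
  obtains ds where "Seq t A B ds" "\<gamma> = ext_rel \<A> \<C> t A B `` {ds}"
  using assms by (auto simp: Ext_def ext_seqs_pos elim!: quotientE)

lemma Ext_I: "t \<ge> 1 \<Longrightarrow> Seq t A B ds \<Longrightarrow> ext_rel \<A> \<C> t A B `` {ds} \<in> Ext \<A> \<C> t A B"
  by (auto simp: Ext_def ext_seqs_pos intro: quotientI)

lemma class_eq:
  assumes "t \<ge> 1" "Seq t A B ds" "Seq t A B es" "seq_map \<A> (Ident \<A> B) (Ident \<A> A) ds es"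
  shows "ext_rel \<A> \<C> t A B `` {ds} = ext_rel \<A> \<C> t A B `` {es}"
  using assms by (intro equiv_class_eq[OF equiv_ext_rel]) (auto simp: ext_rel_iff ext_step_iff)

text \<open>In positive degree, (1) implies (2) with a prescribed deflation \<open>p\<close> onto
  \<open>X\<close> as the morphism along which one pushes out. The group assumed to vanish is the
  one containing the product of \<open>\<eta>\<close> with the conflation of
  \<open>p\<close>.\<close>

lemma pull_imp_push:
  assumes t: "t \<ge> 1" and ip: "conflation \<A> \<C> i p" "Cod \<A> p = X"
    and van: "Ext_vanishes \<A> \<C> (Suc t) P (Dom \<A> i)"
    and \<eta>: "\<eta> \<in> Ext \<A> \<C> t P X" and f: "f \<in> Hom \<A> Z P" and Z: "Z \<in> \<C>"
  shows "\<exists>\<eta>' \<in> Ext \<A> \<C> t Z (Dom \<A> p). ext_pull \<A> \<C> t X \<eta> f = ext_push \<A> \<C> t Z p \<eta>'"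
proof -
  obtain es where es: "Seq t P X es" "\<eta> = ext_rel \<A> \<C> t P X `` {es}" using Ext_E[OF t \<eta>] .
  have f': "f \<in> Arr \<A>" "Dom \<A> f = Z" "Cod \<A> f = P" using f by (auto simp: Hom_iff)
  obtain cs where pull: "pull_seq \<A> f es cs" using ex_pull_seq[OF es(1), of f] f' Z by auto
  have cs: "Seq t Z X cs" "seq_map \<A> (Ident \<A> X) f cs es"
    using pull_seq_Seq[OF es(1) pull] f' Z by auto
  obtain e0 es1 where es1: "es = e0 # es1" using Seq_first[OF es(1)] by metis
  \<comment> \<open>This list is the splice of the conflation with \<open>es\<close>, representing
    that product in degree \<open>t + 1\<close>.\<close>
  have "Seq (Suc t) P (Dom \<A> i) (i # (hd es \<cdot> p) # tl es)"
    using spliced.splice[of "conflation \<A> \<C>" i p \<A> "Dom \<A> i" X t P e0 es1] ip es(1) es1 by simp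
  then have "null_left (Suc t) P (Dom \<A> i) (i # (hd es \<cdot> p) # tl es)"
    using Ext_vanishes_null_left[OF _ van] by simp
  then obtain cs' rs where cs': "Seq t Z X cs'" "seq_map \<A> (Ident \<A> X) (Ident \<A> Z) cs cs'"
    and rs: "Seq t Z (Dom \<A> p) rs" "seq_map \<A> p (Ident \<A> Z) rs cs'"
    using lift_along_deflation[OF es(1) ip _ cs(1) f' cs(2)] by blast
  have "ext_pull \<A> \<C> t X \<eta> f = ext_rel \<A> \<C> t Z X `` {cs'}"
    using ext_pull_class[OF t es(1) cs(1) f' cs(2)] class_eq[OF t cs(1) cs'] es(2) by simp
  moreover have "ext_push \<A> \<C> t Z p (ext_rel \<A> \<C> t Z (Dom \<A> p) `` {rs}) = ext_rel \<A> \<C> t Z X `` {cs'}"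
    using ext_push_class[OF t rs(1) cs'(1) _ _ ip(2) rs(2)] conflationD[OF ip(1)] by simp
  ultimately show ?thesis using Ext_I[OF t rs(1)] by metis
qed

text \<open>The dual passage, with a prescribed inflation \<open>i\<close> out of \<open>Z\<close>.
  Vanishing is always turned into left nullness, while extending along \<open>i\<close> needs right
  nullness, so the equivalence of the two enters here a second time.\<close>

lemma push_imp_pull:
  assumes t: "t \<ge> 1" and ip: "conflation \<A> \<C> i p" "Dom \<A> i = Z"
    and van: "Ext_vanishes \<A> \<C> (Suc t) (Cod \<A> p) Q"
    and \<eta>: "\<eta> \<in> Ext \<A> \<C> t Z Q" and f: "f \<in> Hom \<A> Q X" and X: "X \<in> \<C>"
  shows "\<exists>\<eta>' \<in> Ext \<A> \<C> t (Cod \<A> i) X. ext_push \<A> \<C> t Z f \<eta> = ext_pull \<A> \<C> t X \<eta>' i"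
proof -
  obtain es where es: "Seq t Z Q es" "\<eta> = ext_rel \<A> \<C> t Z Q `` {es}" using Ext_E[OF t \<eta>] .
  have f': "f \<in> Arr \<A>" "Dom \<A> f = Q" "Cod \<A> f = X" using f by (auto simp: Hom_iff)
  obtain cs where push: "push_seq \<A> f es cs" using ex_push_seq[OF es(1), of f] f' X by auto
  have cs: "Seq t Z X cs" "seq_map \<A> f (Ident \<A> Z) es cs"
    using push_seq_Seq[OF es(1) push] f' X by auto
  have "es \<noteq> []" using SeqD(2)[OF es(1)] by auto
  then have null: "null_left (Suc t) (Cod \<A> p) Q (butlast es @ [i \<cdot> last es, p])"
    and Seq: "Seq (Suc t) (Cod \<A> p) Q (butlast es @ [i \<cdot> last es, p])"
    using Seq_snoc[of t Z Q "butlast es" "last es" i p] ip es(1) Ext_vanishes_null_left[OF _ van] by auto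
  obtain cs' rs where cs': "Seq t Z X cs'" "seq_map \<A> (Ident \<A> X) (Ident \<A> Z) cs' cs"
    and rs: "Seq t (Cod \<A> i) X rs" "seq_map \<A> (Ident \<A> X) i cs' rs"
    using extend_along_inflation[OF es(1) ip null[unfolded null_left_iff_null_right[OF Seq]] cs(1) f' cs(2)] .
  have "ext_push \<A> \<C> t Z f \<eta> = ext_rel \<A> \<C> t Z X `` {cs'}"
    using ext_push_class[OF t es(1) cs(1) f' cs(2)] class_eq[OF t cs'(1) cs(1) cs'(2)] es(2) by simp
  moreover have "ext_pull \<A> \<C> t X (ext_rel \<A> \<C> t (Cod \<A> i) X `` {rs}) i = ext_rel \<A> \<C> t Z X `` {cs'}"
    using ext_pull_class[OF t rs(1) cs'(1) _ ip(2) _ rs(2)] conflationD[OF ip(1)] by simp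
  ultimately show ?thesis using Ext_I[OF t rs(1)] by metis
qed

text \<open>In degree 0 the relation is the identity, so classes are singletons.\<close>

lemma Ext_0: "\<gamma> \<in> Ext \<A> \<C> 0 A B \<longleftrightarrow> (\<exists>f \<in> Hom \<A> A B. \<gamma> = {[f]})"
  by (auto simp: Ext_def ext_seqs_def ext_rel_def quotient_def)

lemma ext_pull_0:
  assumes "f \<in> Hom \<A> A' A" "g \<in> Hom \<A> A B"
  shows "ext_pull \<A> \<C> 0 B {[g]} f = {[g \<cdot> f]}"
proof -
  have "pull_seq \<A> f [g] es \<longleftrightarrow> es = [g \<cdot> f]" for es
    using assms by (auto simp: Hom_iff pull_seq.simps)
  then show ?thesis
    using assms Comp_Hom[OF assms] by (auto simp: ext_pull_def ext_rel_def ext_seqs_def Hom_iff)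
qed

lemma ext_push_0:
  assumes "f \<in> Hom \<A> A B" "g \<in> Hom \<A> B B'"
  shows "ext_push \<A> \<C> 0 A g {[f]} = {[g \<cdot> f]}"
proof -
  have "push_seq \<A> g [f] es \<longleftrightarrow> es = [g \<cdot> f]" for es
    using assms by (auto simp: Hom_iff push_seq.simps)
  then show ?thesis
    using assms Comp_Hom[OF assms] by (auto simp: ext_push_def ext_rel_def ext_seqs_def Hom_iff)
qed

end

theorem proposition4p3:
  fixes \<A> :: "('o, 'm) ab_cat" and \<C> :: "'o set" and n :: nat
    and X Z :: 'o and \<gamma> :: "'m list set"
  assumes "extension_closed_subcategory \<A> \<C>"
    and "n_Frobenius \<A> \<C> n"
    and "X \<in> \<C>" and "Z \<in> \<C>"
    and "\<gamma> \<in> Ext \<A> \<C> n Z X"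
  shows "(\<exists>P \<eta> f. n_projective \<A> \<C> n P \<and> \<eta> \<in> Ext \<A> \<C> n P X \<and> f \<in> Hom \<A> Z P \<and>
            \<gamma> = ext_pull \<A> \<C> n X \<eta> f)
     \<longleftrightarrow> (\<exists>Q \<eta>' f'. n_projective \<A> \<C> n Q \<and> \<eta>' \<in> Ext \<A> \<C> n Z Q \<and> f' \<in> Hom \<A> Q X \<and>
            \<gamma> = ext_push \<A> \<C> n Z f' \<eta>')"
proof -
  interpret extension_closed_subcategory \<A> \<C> by fact
  have proj_inj: "n_projective \<A> \<C> n P \<longleftrightarrow> n_injective \<A> \<C> n P" for P
    using assms(2) by (simp add: n_Frobenius_def)
  show ?thesis
  proof (cases "n = 0")
    case True
    \<comment> \<open>Both conditions say that the morphism factors as Z to P to X with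
      \<open>P\<close> being \<open>n\<close>-projective; the two factors merely exchange the roles
      of class and morphism.\<close>
    show ?thesis
    proof
      assume "\<exists>P \<eta> f. n_projective \<A> \<C> n P \<and> \<eta> \<in> Ext \<A> \<C> n P X \<and> f \<in> Hom \<A> Z P \<and>
        \<gamma> = ext_pull \<A> \<C> n X \<eta> f"
      then obtain P f g where "n_projective \<A> \<C> n P" "f \<in> Hom \<A> Z P" "g \<in> Hom \<A> P X"
        "\<gamma> = ext_pull \<A> \<C> 0 X {[g]} f"
        by (auto simp: True Ext_0)
      then show "\<exists>Q \<eta>' f'. n_projective \<A> \<C> n Q \<and> \<eta>' \<in> Ext \<A> \<C> n Z Q \<and> f' \<in> Hom \<A> Q X \<and>
        \<gamma> = ext_push \<A> \<C> n Z f' \<eta>'"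
        by (intro exI[of _ P] exI[of _ "{[f]}"] exI[of _ g]) (auto simp: True Ext_0 ext_pull_0 ext_push_0)
    next
      assume "\<exists>Q \<eta>' f'. n_projective \<A> \<C> n Q \<and> \<eta>' \<in> Ext \<A> \<C> n Z Q \<and> f' \<in> Hom \<A> Q X \<and>
        \<gamma> = ext_push \<A> \<C> n Z f' \<eta>'"
      then obtain Q f g where "n_projective \<A> \<C> n Q" "f \<in> Hom \<A> Z Q" "g \<in> Hom \<A> Q X"
        "\<gamma> = ext_push \<A> \<C> 0 Z g {[f]}"
        by (auto simp: True Ext_0)
      then show "\<exists>P \<eta> f. n_projective \<A> \<C> n P \<and> \<eta> \<in> Ext \<A> \<C> n P X \<and> f \<in> Hom \<A> Z P \<and>
        \<gamma> = ext_pull \<A> \<C> n X \<eta> f"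
        by (intro exI[of _ Q] exI[of _ "{[g]}"] exI[of _ f]) (auto simp: True Ext_0 ext_pull_0 ext_push_0)
    qed
  next
    case False
    then have n: "n \<ge> 1" by simp
    show ?thesis
    proof
      assume "\<exists>P \<eta> f. n_projective \<A> \<C> n P \<and> \<eta> \<in> Ext \<A> \<C> n P X \<and> f \<in> Hom \<A> Z P \<and>
        \<gamma> = ext_pull \<A> \<C> n X \<eta> f"
      then obtain P \<eta> f where P: "n_projective \<A> \<C> n P" "\<eta> \<in> Ext \<A> \<C> n P X" "f \<in> Hom \<A> Z P"
        "\<gamma> = ext_pull \<A> \<C> n X \<eta> f" by blast
      obtain Q p i where Q: "n_projective \<A> \<C> n Q" "p \<in> Hom \<A> Q X" "conflation \<A> \<C> i p"
        using assms(2,3) unfolding n_Frobenius_def deflation_def by blast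
      have "Ext_vanishes \<A> \<C> (Suc n) P (Dom \<A> i)"
        using P(1) conflationD(4)[OF Q(3)] by (simp add: n_projective_def)
      then obtain \<eta>' where "\<eta>' \<in> Ext \<A> \<C> n Z Q" "\<gamma> = ext_push \<A> \<C> n Z p \<eta>'"
        using pull_imp_push[OF n Q(3) _ _ P(2,3) assms(4)] Q(2) P(4) by (auto simp: Hom_iff)
      then show "\<exists>Q \<eta>' f'. n_projective \<A> \<C> n Q \<and> \<eta>' \<in> Ext \<A> \<C> n Z Q \<and> f' \<in> Hom \<A> Q X \<and>
        \<gamma> = ext_push \<A> \<C> n Z f' \<eta>'"
        using Q by blast
    next
      assume "\<exists>Q \<eta>' f'. n_projective \<A> \<C> n Q \<and> \<eta>' \<in> Ext \<A> \<C> n Z Q \<and> f' \<in> Hom \<A> Q X \<and>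
        \<gamma> = ext_push \<A> \<C> n Z f' \<eta>'"
      then obtain Q \<eta>' f' where Q: "n_injective \<A> \<C> n Q" "\<eta>' \<in> Ext \<A> \<C> n Z Q" "f' \<in> Hom \<A> Q X"
        "\<gamma> = ext_push \<A> \<C> n Z f' \<eta>'" unfolding proj_inj by blast
      \<comment> \<open>The coincidence of \<open>n\<close>-projectives and
        \<open>n\<close>-injectives is used twice: the \<open>n\<close>-injective receiving
        \<open>Z\<close> serves as the required \<open>n\<close>-projective \<open>P\<close>, and
        the given \<open>n\<close>-projective \<open>Q\<close> is used as an
        \<open>n\<close>-injective, so that degree \<open>n + 1\<close> extensions with left end
        \<open>Q\<close> vanish.\<close>
      obtain P i p where P: "n_projective \<A> \<C> n P" "i \<in> Hom \<A> Z P" "conflation \<A> \<C> i p"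
        using assms(2,4) proj_inj unfolding n_Frobenius_def inflation_def by blast
      have "Ext_vanishes \<A> \<C> (Suc n) (Cod \<A> p) Q"
        using Q(1) conflationD(6)[OF P(3)] by (simp add: n_injective_def)
      then obtain \<eta> where "\<eta> \<in> Ext \<A> \<C> n P X" "\<gamma> = ext_pull \<A> \<C> n X \<eta> i"
        using push_imp_pull[OF n P(3) _ _ Q(2,3) assms(3)] P(2) Q(4) by (auto simp: Hom_iff)
      then show "\<exists>P \<eta> f. n_projective \<A> \<C> n P \<and> \<eta> \<in> Ext \<A> \<C> n P X \<and> f \<in> Hom \<A> Z P \<and>
        \<gamma> = ext_pull \<A> \<C> n X \<eta> f"
        using P by blast
    qed
  qed
qed

end
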